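(* Let $k$ be an infinite field of characteristic $p>2$, and let $G$ be the infinite dimensional unitary Grassmann algebra over $k$. Then $CP(G)=S_1+T(G)$.
   Context: $X=\{x_i\mid i\ge 1\}$ is a countably infinite set; $k_0\langle X\rangle$ is the free nonunitary associative $k$-algebra over $X$ and $k_1\langle X\rangle$ is the free unitary associative $k$-algebra over $X$ (so $k_1\langle X\rangle = k\oplus k_0\langle X\rangle$). $[u,v]=uv-vu$. A $T$-space of $k_1\langle X\rangle$ is a linear subspace invariant under every (unital) endomorphism of $k_1\langle X\rangle$; for $Y\subseteq k_1\langle X\rangle$, $Y^S$ is the smallest $T$-space of $k_1\langle X\rangle$ containing $Y$. $G$ is the unital associative $k$-algebra generated by $e_i$, $i\ge1$, with $e_ie_j=-e_je_i$ and $e_i^2=0$ for all $i,j$, and with linear basis $\{1\}\cup\{e_{i_1}e_{i_2}\cdots e_{i_n}\mid n\ge 1,\ i_1<i_2<\cdots<i_n\}$. $T(G)$ is the set of identities of $G$: the elements lying in the kernel of every (unital) homomorphism $k_1\langle X\rangle\to G$. A central polynomial of $G$ is an element $f\in k_0\langle X\rangle$ with $f\notin T(G)$ whose image under every homomorphism $k_1\langle X\rangle\to G$ lies in the centre of $G$. $CP(G)$ is the $T$-space of $k_1\langle X\rangle$ generated by the central polynomials of $G$. Definition of $S_1$ (for $p>2$), with $T$-spaces taken in $k_1\langle X\rangle$: $$S_1=\{[x_1,x_2],x_1^p\}^S+\Bigl\{x_1^p\prod_{i=1}^n[x_{2i},x_{2i+1}]x_{2i}^{p-1}x_{2i+1}^{p-1}\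 \Bigm|\ n\ge1\Bigr\}^S.$$ *)

theory Defs
  imports Complex_Main "HOL-Library.Poly_Mapping" "HOL-Library.Set_Algebras"
begin

section \<open>The free associative algebra\<close>

text \<open>
  \<open>k\<^sub>1\<langle>X\<rangle>\<close> is the monoid algebra over \<open>k\<close> of the free monoid on a countably infinite
  alphabet: multiplication on \<open>M \<Rightarrow>\<^sub>0 k\<close> is convolution with respect to the additively
  written, here noncommutative, monoid \<open>M\<close>. Letters are indexed by all natural numbers,
  so \<open>X\<close> is \<open>{x\<^sub>0, x\<^sub>1, \<dots>}\<close>, with \<open>x\<^sub>i\<close> rendered \<open>fvar i\<close>.
\<close>

datatype fmon = Word (letters: "nat list")

instantiation fmon :: monoid_add
begin

definition zero_fmon :: fmon where "0 = Word []"

definition plus_fmon :: "fmon \<Rightarrow> fmon \<Rightarrow> fmon"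
  where "u + v = Word (letters u @ letters v)"

instance
  by standard (simp_all add: zero_fmon_def plus_fmon_def)

end

type_synonym 'k free_alg = "fmon \<Rightarrow>\<^sub>0 'k"

definition fvar :: "nat \<Rightarrow> 'k::field free_alg"
  where "fvar i = Poly_Mapping.single (Word [i]) 1"

definition fscale :: "'k::field \<Rightarrow> 'k free_alg \<Rightarrow> 'k free_alg"
  where "fscale c f = Poly_Mapping.map ((*) c) f"

lemma lookup_fscale: "Poly_Mapping.lookup (fscale c f) w = c * Poly_Mapping.lookup f w"
  unfolding fscale_def by (simp add: map.rep_eq when_def)

global_interpretation free_alg: vector_space "fscale :: 'k::field \<Rightarrow> _"
  by standard
    (auto intro!: poly_mapping_eqI simp: lookup_fscale lookup_add algebra_simps)

definition nonunitary :: "'k::field free_alg set"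
  where "nonunitary = {f. Poly_Mapping.lookup f 0 = 0}"

definition commutator :: "'a::ring \<Rightarrow> 'a \<Rightarrow> 'a"
  where "commutator u v = u * v - v * u"

text \<open>Homomorphisms of unital \<open>k\<close>-algebras, with respect to given scalar multiplications.\<close>

definition unital_alg_hom ::
    "('k::field \<Rightarrow> 'a::ring_1 \<Rightarrow> 'a) \<Rightarrow> ('k \<Rightarrow> 'b::ring_1 \<Rightarrow> 'b) \<Rightarrow> ('a \<Rightarrow> 'b) \<Rightarrow> bool"
  where "unital_alg_hom s1 s2 \<phi> \<longleftrightarrow>
    Vector_Spaces.linear s1 s2 \<phi> \<and> (\<forall>a b. \<phi> (a * b) = \<phi> a * \<phi> b) \<and> \<phi> 1 = 1"

definition T_space :: "'k::field free_alg set \<Rightarrow> bool"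
  where "T_space V \<longleftrightarrow>
    free_alg.subspace V \<and> (\<forall>\<phi>. unital_alg_hom fscale fscale \<phi> \<longrightarrow> \<phi> ` V \<subseteq> V)"

definition T_space_gen :: "'k::field free_alg set \<Rightarrow> 'k free_alg set"
  where "T_space_gen Y = \<Inter>{V. T_space V \<and> Y \<subseteq> V}"

lemma T_space_T_space_gen: "T_space (T_space_gen Y)"
  unfolding T_space_gen_def T_space_def
  by (auto intro!: free_alg.subspace_Inter)

lemma T_space_gen_superset: "Y \<subseteq> T_space_gen Y"
  by (auto simp: T_space_gen_def)

lemma T_space_gen_least: "T_space V \<Longrightarrow> Y \<subseteq> V \<Longrightarrow> T_space_gen Y \<subseteq> V"
  by (auto simp: T_space_gen_def)


section \<open>The infinite dimensional unitary Grassmann algebra\<close>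

text \<open>
  An element is stored as its coefficients with respect to the basis of monomials
  \<open>e\<^sub>A = e\<^bsub>i1\<^esub> \<cdots> e\<^bsub>in\<^esub>\<close>, where \<open>A = {i1 < \<dots> < in}\<close> is a finite set of natural numbers and
  \<open>e\<^bsub>{}\<^esub> = 1\<close>. If \<open>A\<close> and \<open>B\<close> meet then \<open>e\<^sub>A e\<^sub>B = 0\<close>; otherwise \<open>e\<^sub>A e\<^sub>B = \<plusminus>e\<^bsub>A \<union> B\<^esub>\<close>, where the
  sign is the parity of the number of transpositions needed to sort the factors.
\<close>

definition gsign :: "nat set \<Rightarrow> nat set \<Rightarrow> 'k::comm_ring_1"
  where "gsign A B = (- 1) ^ card {(a, b). a \<in> A \<and> b \<in> B \<and> b < a}"

lemma gsign_empty [simp]: "gsign {} B = 1" "gsign A {} = 1"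
  by (simp_all add: gsign_def)

lemma finite_inversions:
  assumes "finite A" "finite B"
  shows "finite {(a, b). a \<in> A \<and> b \<in> B \<and> b < (a::nat)}"
  by (rule finite_subset[of _ "A \<times> B"]) (use assms in auto)

lemma gsign_Un_left:
  assumes "finite A" "finite B" "finite C" "A \<inter> B = {}"
  shows "gsign (A \<union> B) C = (gsign A C * gsign B C :: 'k::comm_ring_1)"
proof -
  have "{(a, b). a \<in> A \<union> B \<and> b \<in> C \<and> b < a} =
      {(a, b). a \<in> A \<and> b \<in> C \<and> b < a} \<union> {(a, b). a \<in> B \<and> b \<in> C \<and> b < a}"
    by auto
  then have "card {(a, b). a \<in> A \<union> B \<and> b \<in> C \<and> b < a} =
      card {(a, b). a \<in> A \<and> b \<in> C \<and> b < a} + card {(a, b). a \<in> B \<and> b \<in> C \<and> b < a}"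
    using assms by (auto intro!: card_Un_disjoint finite_inversions)
  then show ?thesis by (simp add: gsign_def power_add)
qed

lemma gsign_Un_right:
  assumes "finite A" "finite B" "finite C" "B \<inter> C = {}"
  shows "gsign A (B \<union> C) = (gsign A B * gsign A C :: 'k::comm_ring_1)"
proof -
  have "{(a, b). a \<in> A \<and> b \<in> B \<union> C \<and> b < a} =
      {(a, b). a \<in> A \<and> b \<in> B \<and> b < a} \<union> {(a, b). a \<in> A \<and> b \<in> C \<and> b < a}"
    by auto
  then have "card {(a, b). a \<in> A \<and> b \<in> B \<union> C \<and> b < a} =
      card {(a, b). a \<in> A \<and> b \<in> B \<and> b < a} + card {(a, b). a \<in> A \<and> b \<in> C \<and> b < a}"
    using assms by (auto intro!: card_Un_disjoint finite_inversions)
  then show ?thesis by (simp add: gsign_def power_add)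
qed

typedef (overloaded) 'k grassmann =
  "{f :: nat set \<Rightarrow> 'k::zero. finite {A. f A \<noteq> 0} \<and> (\<forall>A. infinite A \<longrightarrow> f A = 0)}"
  morphisms gcoeff Abs_grassmann
  by (rule exI[of _ "\<lambda>_. 0"]) auto

setup_lifting type_definition_grassmann

instantiation grassmann :: (comm_ring_1) ring_1
begin

lift_definition zero_grassmann :: "'a grassmann" is "\<lambda>_. 0" by auto

lift_definition one_grassmann :: "'a grassmann" is "\<lambda>A. if A = {} then 1 else 0" by auto

lift_definition plus_grassmann :: "'a grassmann \<Rightarrow> 'a grassmann \<Rightarrow> 'a grassmann"
  is "\<lambda>f g A. f A + g A"
proof safe
  fix f g :: "nat set \<Rightarrow> 'a"
  assume "finite {A. f A \<noteq> 0}" "finite {A. g A \<noteq> 0}"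
  then show "finite {A. f A + g A \<noteq> 0}"
    by (rule_tac finite_subset[of _ "{A. f A \<noteq> 0} \<union> {A. g A \<noteq> 0}"]) auto
qed auto

lift_definition uminus_grassmann :: "'a grassmann \<Rightarrow> 'a grassmann"
  is "\<lambda>f A. - f A" by auto

lift_definition minus_grassmann :: "'a grassmann \<Rightarrow> 'a grassmann \<Rightarrow> 'a grassmann"
  is "\<lambda>f g A. f A - g A"
proof safe
  fix f g :: "nat set \<Rightarrow> 'a"
  assume "finite {A. f A \<noteq> 0}" "finite {A. g A \<noteq> 0}"
  then show "finite {A. f A - g A \<noteq> 0}"
    by (rule_tac finite_subset[of _ "{A. f A \<noteq> 0} \<union> {A. g A \<noteq> 0}"]) auto
qed auto

lift_definition times_grassmann :: "'a grassmann \<Rightarrow> 'a grassmann \<Rightarrow> 'a grassmann"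
  is "\<lambda>f g C. \<Sum>A\<in>Pow C. gsign A (C - A) * f A * g (C - A)"
proof safe
  fix f g :: "nat set \<Rightarrow> 'a"
  let ?h = "\<lambda>C. \<Sum>A\<in>Pow C. gsign A (C - A) * f A * g (C - A)"
  assume fin: "finite {A. f A \<noteq> 0}" "finite {A. g A \<noteq> 0}"
  have "{C. ?h C \<noteq> 0} \<subseteq> (\<lambda>(A, B). A \<union> B) ` ({A. f A \<noteq> 0} \<times> {A. g A \<noteq> 0})"
  proof
    fix C assume "C \<in> {C. ?h C \<noteq> 0}"
    then obtain A where "A \<subseteq> C" "gsign A (C - A) * f A * g (C - A) \<noteq> 0"
      by (auto elim: sum.not_neutral_contains_not_neutral)
    then have "f A \<noteq> 0" "g (C - A) \<noteq> 0" "C = A \<union> (C - A)" by auto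
    then show "C \<in> (\<lambda>(A, B). A \<union> B) ` ({A. f A \<noteq> 0} \<times> {A. g A \<noteq> 0})"
      by (intro image_eqI[of _ _ "(A, C - A)"]) auto
  qed
  with fin show "finite {C. ?h C \<noteq> 0}"
    by (meson finite_SigmaI finite_imageI finite_subset)
next
  fix f g :: "nat set \<Rightarrow> 'a" and C :: "nat set"
  assume "infinite C"
  then show "(\<Sum>A\<in>Pow C. gsign A (C - A) * f A * g (C - A)) = 0" by simp
qed

instance
proof
  fix a b c :: "'a grassmann"
  show "a * b * c = a * (b * c)"
  proof (transfer, rule ext)
    fix f g h :: "nat set \<Rightarrow> 'a" and C :: "nat set"
    show "(\<Sum>D\<in>Pow C. gsign D (C - D) *
            (\<Sum>A\<in>Pow D. gsign A (D - A) * f A * g (D - A)) * h (C - D)) =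
          (\<Sum>A\<in>Pow C. gsign A (C - A) * f A *
            (\<Sum>B\<in>Pow (C - A). gsign B (C - A - B) * g B * h (C - A - B)))"
    proof (cases "finite C")
      case True
      note fin = finite_subset[OF _ True]
      have "(\<Sum>D\<in>Pow C. gsign D (C - D) *
              (\<Sum>A\<in>Pow D. gsign A (D - A) * f A * g (D - A)) * h (C - D)) =
            (\<Sum>D\<in>Pow C. \<Sum>A\<in>Pow D. gsign D (C - D) * gsign A (D - A) *
              f A * g (D - A) * h (C - D))"
        by (simp add: sum_distrib_left sum_distrib_right mult.assoc)
      also have "\<dots> = (\<Sum>(D, A)\<in>Sigma (Pow C) Pow. gsign D (C - D) * gsign A (D - A) *
              f A * g (D - A) * h (C - D))"
        by (rule sum.Sigma) (auto simp: True fin)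
      also have "\<dots> = (\<Sum>(A, B)\<in>Sigma (Pow C) (\<lambda>A. Pow (C - A)).
              gsign A (C - A) * gsign B (C - A - B) * f A * g B * h (C - A - B))"
      proof (rule sum.reindex_bij_witness[where
            i = "\<lambda>(A, B). (A \<union> B, A)" and j = "\<lambda>(D, A). (A, D - A)"], goal_cases)
        case (5 x)
        obtain D A where x: "x = (D, A)" "D \<subseteq> C" "A \<subseteq> D" using 5 by auto
        have "gsign D (C - D) = (gsign (A \<union> (D - A)) (C - D) :: 'a)"
          using x by (simp add: Un_absorb1)
        also have "\<dots> = gsign A (C - D) * gsign (D - A) (C - D)"
          by (rule gsign_Un_left) (use x fin True in \<open>auto intro: fin\<close>)
        finally have 1: "gsign D (C - D) =
            (gsign A (C - D) * gsign (D - A) (C - D) :: 'a)" .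
        have "C - A = (D - A) \<union> (C - D)" using x by auto
        then have "gsign A (C - A) = (gsign A ((D - A) \<union> (C - D)) :: 'a)" by simp
        also have "\<dots> = gsign A (D - A) * gsign A (C - D)"
          by (rule gsign_Un_right) (use x fin True in \<open>auto intro: fin\<close>)
        finally have 2: "gsign A (C - A) = (gsign A (D - A) * gsign A (C - D) :: 'a)" .
        have 3: "C - A - (D - A) = C - D" using x by auto
        show ?case unfolding x(1) prod.case 3 1 2 by (simp add: ac_simps)
      qed auto
      also have "\<dots> = (\<Sum>A\<in>Pow C. \<Sum>B\<in>Pow (C - A).
              gsign A (C - A) * gsign B (C - A - B) * f A * g B * h (C - A - B))"
        by (rule sum.Sigma[symmetric]) (auto simp: True)
      also have "\<dots> = (\<Sum>A\<in>Pow C. gsign A (C - A) * f A *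
            (\<Sum>B\<in>Pow (C - A). gsign B (C - A - B) * g B * h (C - A - B)))"
        by (simp add: sum_distrib_left ac_simps)
      finally show ?thesis .
    qed simp
  qed
  show "1 * a = a"
  proof (transfer, rule ext)
    fix f :: "nat set \<Rightarrow> 'a" and C :: "nat set"
    assume f: "finite {A. f A \<noteq> 0} \<and> (\<forall>A. infinite A \<longrightarrow> f A = 0)"
    have "(\<Sum>A\<in>Pow C. gsign A (C - A) * (if A = {} then 1 else 0) * f (C - A)) =
        (\<Sum>A\<in>Pow C. if A = {} then f C else 0)"
      by (rule sum.cong) auto
    then show "(\<Sum>A\<in>Pow C. gsign A (C - A) * (if A = {} then 1 else 0) * f (C - A)) = f C"
      using f by (cases "finite C") auto
  qed
  show "a * 1 = a"
  proof (transfer, rule ext)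
    fix f :: "nat set \<Rightarrow> 'a" and C :: "nat set"
    assume f: "finite {A. f A \<noteq> 0} \<and> (\<forall>A. infinite A \<longrightarrow> f A = 0)"
    have "(\<Sum>A\<in>Pow C. gsign A (C - A) * f A * (if C - A = {} then 1 else 0)) =
        (\<Sum>A\<in>Pow C. if A = C then f C else 0)"
      by (rule sum.cong) auto
    then show "(\<Sum>A\<in>Pow C. gsign A (C - A) * f A * (if C - A = {} then 1 else 0)) = f C"
      using f by (cases "finite C") auto
  qed
  show "(0::'a grassmann) \<noteq> 1" by transfer (metis zero_neq_one)
qed (transfer; simp add: algebra_simps sum.distrib fun_eq_iff)+

end

lift_definition gscale :: "'k::field \<Rightarrow> 'k grassmann \<Rightarrow> 'k grassmann"
  is "\<lambda>c f A. c * f A"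
proof safe
  fix c :: 'k and f :: "nat set \<Rightarrow> 'k"
  assume "finite {A. f A \<noteq> 0}"
  then show "finite {A. c * f A \<noteq> 0}" by (rule rev_finite_subset) auto
qed auto

global_interpretation grassmann: vector_space "gscale :: 'k::field \<Rightarrow> _"
  by standard (transfer; simp add: algebra_simps fun_eq_iff)+

lemma gscale_mult_left: "gscale c a * b = gscale c (a * b)"
  by transfer (simp add: fun_eq_iff sum_distrib_left ac_simps)

lemma gscale_mult_right: "a * gscale c b = gscale c (a * b)"
  by transfer (simp add: fun_eq_iff sum_distrib_left ac_simps)

lift_definition gmonom :: "nat set \<Rightarrow> 'k::field grassmann"
  is "\<lambda>A B. if finite A \<and> B = A then 1 else 0"
  by auto

definition ggen :: "nat \<Rightarrow> 'k::field grassmann"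
  where "ggen i = gmonom {i}"

text \<open>
  The following facts identify the type as the Grassmann algebra: the defining relations
  of the generators \<open>e\<^sub>i\<close> (rendered \<open>ggen i\<close>), and the basis of increasing products (the empty one being \<open>1\<close>).
\<close>

lemma gmonom_mult:
  assumes "finite A" "finite B"
  shows "gmonom A * gmonom B =
    (if A \<inter> B = {} then gscale (gsign A B) (gmonom (A \<union> B)) else 0)"
  using assms
proof (transfer, intro ext)
  fix A B C :: "nat set"
  assume fin: "finite A" "finite B"
  show "(\<Sum>D\<in>Pow C. gsign D (C - D) * (if finite A \<and> D = A then 1 else 0) *
          (if finite B \<and> C - D = B then 1 else 0)) =
        (if A \<inter> B = {}
         then \<lambda>D. gsign A B * (if finite (A \<union> B) \<and> D = A \<union> B then 1 else 0)
         else (\<lambda>_. 0 :: 'a)) C" (is "?l = ?r")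
  proof -
    have "?l = (\<Sum>D\<in>Pow C. if D = A then if C - A = B then gsign A B else 0 else 0)"
      by (rule sum.cong) (use fin in auto)
    also have "\<dots> = (if finite C \<and> A \<subseteq> C \<and> C - A = B then gsign A B else 0)"
      by (cases "finite C") auto
    also have "(finite C \<and> A \<subseteq> C \<and> C - A = B) \<longleftrightarrow> A \<inter> B = {} \<and> C = A \<union> B"
      using fin by auto
    finally show ?thesis using fin by auto
  qed
qed

lemma ggen_anticommute: "ggen i * ggen j = - (ggen j * ggen i)"
proof (cases "i = j")
  case False
  have "card {(a, b). a = i \<and> b = j \<and> b < a} = (if j < i then 1 else 0)" for i j :: nat
  proof -
    have "{(a, b). a = i \<and> b = j \<and> b < a} = (if j < i then {(i, j)} else {})" by auto
    then show ?thesis by simp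
  qed
  then have "gsign {i} {j} = (- gsign {j} {i} :: 'a)"
    using False by (simp add: gsign_def)
  then show ?thesis using False
    by (simp add: ggen_def gmonom_mult insert_commute)
qed (simp add: ggen_def gmonom_mult)

lemma ggen_square: "ggen i * ggen i = 0"
  by (simp add: ggen_def gmonom_mult)

lemma prod_ggen: "finite A \<Longrightarrow> prod_list (map ggen (sorted_list_of_set A)) = gmonom A"
proof (induction "card A" arbitrary: A)
  case 0
  then have "A = {}" by simp
  moreover have "gmonom {} = (1 :: 'a grassmann)" by transfer simp
  ultimately show ?case by simp
next
  case (Suc n)
  then have ne: "A \<noteq> {}" by auto
  define m where "m = Min A"
  have m: "m \<in> A" using Suc.prems ne by (simp add: m_def)
  have "prod_list (map ggen (sorted_list_of_set (A - {m}))) = (gmonom (A - {m}) :: 'a grassmann)"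
    by (rule Suc.hyps) (use Suc m in auto)
  moreover have "sorted_list_of_set A = m # sorted_list_of_set (A - {m})"
    unfolding m_def using Suc.prems ne by (rule sorted_list_of_set_nonempty)
  moreover have "{(a, b). a \<in> {m} \<and> b \<in> A - {m} \<and> b < a} = {}"
    using Suc.prems by (auto simp: m_def dest: Min_le leD)
  then have "gsign {m} (A - {m}) = (1 :: 'a)" unfolding gsign_def by (simp only: card.empty power_0)
  ultimately show ?case
    using Suc.prems m by (simp add: ggen_def gmonom_mult insert_absorb)
qed

lemma inj_gmonom: "inj_on gmonom {A. finite A}"
  by (rule inj_onI, transfer) (metis mem_Collect_eq zero_neq_one)

lemma gcoeff_sum: "gcoeff (sum f I) A = (\<Sum>i\<in>I. gcoeff (f i) A)"
  by (induction I rule: infinite_finite_induct)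
    (simp_all add: zero_grassmann.rep_eq plus_grassmann.rep_eq)

theorem ggen_independent:
  "grassmann.independent {prod_list (map ggen (sorted_list_of_set A)) | A. finite A}"
proof -
  have eq: "{prod_list (map ggen (sorted_list_of_set A)) | A. finite A} =
      (gmonom ` {A. finite A} :: 'a grassmann set)"
    using prod_ggen by (auto simp: image_iff) metis+
  show ?thesis unfolding eq grassmann.independent_explicit_module
  proof (intro allI impI)
    fix T u and v :: "'a grassmann"
    assume T: "finite T" "T \<subseteq> gmonom ` {A. finite A}"
      and 0: "(\<Sum>w\<in>T. gscale (u w) w) = 0" and "v \<in> T"
    have inj: "inj_on (gmonom :: _ \<Rightarrow> 'a grassmann) {A. finite A}" by (rule inj_gmonom)
    from \<open>v \<in> T\<close> T(2) obtain A where A: "finite A" "v = gmonom A" by auto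
    have "0 = (\<Sum>w\<in>T. u w * gcoeff w A)"
      using arg_cong[OF 0, of "\<lambda>x. gcoeff x A"]
      by (simp add: gcoeff_sum gscale.rep_eq zero_grassmann.rep_eq)
    also have "\<dots> = (\<Sum>w\<in>T. if w = v then u v else 0)"
    proof (rule sum.cong)
      fix w assume "w \<in> T"
      with T(2) obtain B where "finite B" "w = gmonom B" by auto
      then show "u w * gcoeff w A = (if w = v then u v else 0)"
        using A inj_onD[OF inj, of A B] by (cases "A = B") (auto simp: gmonom.rep_eq)
    qed simp
    also have "\<dots> = u v" using T(1) \<open>v \<in> T\<close> by simp
    finally show "u v = 0" by simp
  qed
qed

theorem ggen_span:
  "grassmann.span {prod_list (map ggen (sorted_list_of_set A)) | A. finite A} = UNIV"
proof -
  have eq: "{prod_list (map ggen (sorted_list_of_set A)) | A. finite A} =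
      (gmonom ` {A. finite A} :: 'a grassmann set)"
    using prod_ggen by (auto simp: image_iff) metis+
  have "a \<in> grassmann.span (gmonom ` {A. finite A})" for a :: "'a grassmann"
  proof -
    let ?S = "{A. gcoeff a A \<noteq> 0}"
    have S: "finite ?S" "\<And>A. A \<in> ?S \<Longrightarrow> finite A" using gcoeff[of a] by auto
    have "a = (\<Sum>A\<in>?S. gscale (gcoeff a A) (gmonom A))"
    proof (rule gcoeff_inject[THEN iffD1], rule ext)
      fix B
      have "gcoeff (\<Sum>A\<in>?S. gscale (gcoeff a A) (gmonom A)) B =
          (\<Sum>A\<in>?S. if A = B then gcoeff a B else 0)"
        unfolding gcoeff_sum
        by (rule sum.cong) (use S in \<open>auto simp: gscale.rep_eq gmonom.rep_eq\<close>)
      then show "gcoeff a B = gcoeff (\<Sum>A\<in>?S. gscale (gcoeff a A) (gmonom A)) B"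
        using S(1) by simp
    qed
    also have "\<dots> \<in> grassmann.span (gmonom ` {A. finite A})"
      by (intro grassmann.span_sum grassmann.span_scale grassmann.span_base) (use S in auto)
    finally show ?thesis .
  qed
  then show ?thesis unfolding eq by auto
qed


section \<open>Identities and central polynomials of the Grassmann algebra\<close>

definition T_G :: "'k::field free_alg set"
  where "T_G = {f. \<forall>\<phi> :: 'k free_alg \<Rightarrow> 'k grassmann.
    unital_alg_hom fscale gscale \<phi> \<longrightarrow> \<phi> f = 0}"

definition centre :: "'a::ring_1 set"
  where "centre = {z. \<forall>a. z * a = a * z}"

definition central_polynomial :: "'k::field free_alg \<Rightarrow> bool"
  where "central_polynomial f \<longleftrightarrow> f \<in> nonunitary \<and> f \<notin> T_G \<and>
    (\<forall>\<phi> :: 'k free_alg \<Rightarrow> 'k grassmann. unital_alg_hom fscale gscale \<phi> \<longrightarrow> \<phi> f \<in> centre)"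

definition CP_G :: "'k::field free_alg set"
  where "CP_G = T_space_gen {f. central_polynomial f}"

text \<open>
  The product over \<open>i = 1, \<dots>, n\<close> is noncommutative, with factors in increasing order of \<open>i\<close>;
  \<open>+\<close> is the sum of subspaces.
\<close>

definition S1 :: "nat \<Rightarrow> 'k::field free_alg set"
  where "S1 p =
    T_space_gen {commutator (fvar 1) (fvar 2), fvar 1 ^ p} +
    T_space_gen {fvar 1 ^ p * (\<Prod>i\<leftarrow>[1..<n+1].
        commutator (fvar (2*i)) (fvar (2*i+1)) * fvar (2*i) ^ (p-1) * fvar (2*i+1) ^ (p-1)) | n. n \<ge> 1}"

end

theory Submission
  imports Defs "HOL-Computational_Algebra.Primes"
begin

text \<open>
  Up to the constants, \<open>CP(G)\<close> consists of the \<open>f\<close> all of whose values in \<open>G\<close> are central, that is, even.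
  For such \<open>f\<close>, let \<open>D\<^sub>i f\<close> be the cyclic derivative, sending a word to the sum of \<open>v u\<close> over its
  factorisations \<open>u x\<^sub>i v\<close>. Changing the value of \<open>x\<^sub>i\<close> by a basis monomial \<open>h\<close> with \<open>h G h = 0\<close>
  changes \<open>\<phi>(f)\<close> by \<open>\<phi>(D\<^sub>i f) h\<close> modulo commutators, so \<open>\<phi>(D\<^sub>i f) h\<close> is even; taking \<open>h\<close> of length one
  and two in fresh generators forces \<open>\<phi>(D\<^sub>i f) = 0\<close>. Rotating words shows that the Euler operator
  satisfies \<open>E\<^sub>i f \<equiv> (D\<^sub>i f) x\<^sub>i\<close> modulo commutators, hence \<open>E\<^sub>i f \<in> S\<^sub>1 + T(G)\<close>. The eigenvalues of \<open>E\<^sub>i\<close>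
  lie in the prime field, so modulo \<open>S\<^sub>1 + T(G)\<close> only words whose degree in every letter is divisible by \<open>p\<close>
  survive. In \<open>G\<close> commutators are central and a product of commutators with a repeated
  letter vanishes, so sorting the letters of such a word expresses it through the generators of \<open>S\<^sub>1\<close>.
\<close>

section \<open>Homomorphisms out of the free algebra\<close>

abbreviation mon :: "nat list \<Rightarrow> 'k::field free_alg"
  where "mon u \<equiv> Poly_Mapping.single (Word u) 1"

lemma fmon_sum_monomials:
  "f = (\<Sum>w\<in>Poly_Mapping.keys f. fscale (Poly_Mapping.lookup f w) (mon (letters w)))" for f :: "'k::field free_alg"
proof (rule poly_mapping_eqI)
  fix v
  have "Poly_Mapping.lookup (\<Sum>w\<in>Poly_Mapping.keys f. fscale (Poly_Mapping.lookup f w) (mon (letters w))) v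
      = (\<Sum>w\<in>Poly_Mapping.keys f. if w = v then Poly_Mapping.lookup f v else 0)"
    unfolding lookup_sum by (rule sum.cong) (auto simp: lookup_fscale lookup_single when_def)
  then show "Poly_Mapping.lookup f v = Poly_Mapping.lookup (\<Sum>w\<in>Poly_Mapping.keys f. fscale (Poly_Mapping.lookup f w) (mon (letters w))) v"
    by (simp add: in_keys_iff)
qed

lemma span_mon: "free_alg.span (range mon) = (UNIV :: 'k::field free_alg set)"
proof -
  have "f \<in> free_alg.span (range mon)" for f :: "'k free_alg"
    by (subst fmon_sum_monomials[of f])
      (intro free_alg.span_sum free_alg.span_scale free_alg.span_base rangeI)
  then show ?thesis by blast
qed

lemma fscale_eq_mult: "fscale c f = Poly_Mapping.single 0 c * f"
  unfolding fscale_def by (rule mult_map_scale_conv_mult)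

lemma fscale_mult_left: "fscale c a * b = fscale c (a * b)"
  by (simp add: fscale_eq_mult mult.assoc)

lemma mon_mult: "mon u * mon v = mon (u @ v)"
  by (simp add: mult_single plus_fmon_def)

lemma mon_Nil: "mon [] = 1"
  by (metis single_one zero_fmon_def)

lemma mon_Cons: "mon (i # u) = fvar i * mon u"
  by (simp add: fvar_def mon_mult)

lemma fmon_induct [consumes 0, case_names mon add scale]:
  assumes "\<And>u. P (mon u)" "\<And>f g. P f \<Longrightarrow> P g \<Longrightarrow> P (f + g)" "\<And>c f. P f \<Longrightarrow> P (fscale c f)"
  shows "P (f :: 'k::field free_alg)"
proof -
  \<comment> \<open>Scaling a word by 0 supplies the zero case, so the rule needs no separate case
    for it.\<close>
  have "P 0" using assms(3)[of "mon []" 0] assms(1) by simp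
  moreover have "f \<in> free_alg.span (range mon)" by (simp add: span_mon)
  ultimately show ?thesis
    by (rule_tac free_alg.span_induct_alt[of f "range mon" P]) (auto intro: assms)
qed

text \<open>Scalars sit at the empty word, which is neutral on both sides, so they commute with
  words; bilinearity does the rest.\<close>

lemma fscale_mult_right: "a * fscale c b = fscale c (a * b)" for a b :: "'k::field free_alg"
proof (induction a rule: fmon_induct)
  case (mon u)
  show ?case
  proof (induction b arbitrary: c rule: fmon_induct)
    case (mon v)
    show ?case by (simp add: fscale_eq_mult mult_single)
  next
    case (add f g)
    then show ?case by (simp add: distrib_left free_alg.scale_right_distrib)
  next
    case (scale d f)
    then show ?case by simp
  qed
next
  case (add f g)
  then show ?case by (simp add: distrib_right free_alg.scale_right_distrib)
next
  case (scale d f)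
  then show ?case by (simp add: fscale_mult_left mult.commute)
qed

section \<open>Linear extension from words and evaluation homomorphisms\<close>

definition lin_ext :: "('k::field \<Rightarrow> 'b::ab_group_add \<Rightarrow> 'b) \<Rightarrow> (nat list \<Rightarrow> 'b) \<Rightarrow> 'k free_alg \<Rightarrow> 'b"
  where "lin_ext s F f = (\<Sum>w\<in>Poly_Mapping.keys f. s (Poly_Mapping.lookup f w) (F (letters w)))"

lemma linear_lin_ext:
  assumes "vector_space s"
  shows "Vector_Spaces.linear fscale s (lin_ext s F)"
proof -
  interpret s: vector_space s by fact
  \<comment> \<open>Terms outside the support vanish, so polynomials with different supports can be
    summed over one common index set.\<close>
  have superset: "lin_ext s F f = (\<Sum>w\<in>K. s (Poly_Mapping.lookup f w) (F (letters w)))"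
    if "finite K" "Poly_Mapping.keys f \<subseteq> K" for f K
    unfolding lin_ext_def by (rule sum.mono_neutral_left) (use that in \<open>auto simp: in_keys_iff\<close>)
  have add: "lin_ext s F (f + g) = lin_ext s F f + lin_ext s F g" for f g
    using keys_add[of f g]
    by (subst (1 2 3) superset[of "Poly_Mapping.keys f \<union> Poly_Mapping.keys g"])
      (auto simp: lookup_add s.scale_left_distrib sum.distrib)
  have scale: "lin_ext s F (fscale c f) = s c (lin_ext s F f)" for c f
    by (subst (1 2) superset[of "Poly_Mapping.keys f"])
      (auto simp: lookup_fscale in_keys_iff s.scale_sum_right)
  show ?thesis
    by unfold_locales (auto simp: add scale)
qed

lemma lin_ext_mon: "vector_space s \<Longrightarrow> lin_ext s F (mon u) = F u"
  by (simp add: lin_ext_def vector_space_def)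

definition word_eval :: "(nat \<Rightarrow> 'b::monoid_mult) \<Rightarrow> nat list \<Rightarrow> 'b"
  where "word_eval a u = prod_list (map a u)"

lemma word_eval_simps [simp]:
  "word_eval a [] = 1"
  "word_eval a (i # u) = a i * word_eval a u"
  "word_eval a (u @ v) = word_eval a u * word_eval a v"
  by (simp_all add: word_eval_def)

text \<open>Both the free algebra and G are instances, so one construction yields substitutions as
  well as evaluations in G.\<close>

locale unital_algebra = vector_space scale
  for scale :: "'k::field \<Rightarrow> 'b::ring_1 \<Rightarrow> 'b" +
  assumes mult_left: "scale c a * b = scale c (a * b)"
    and mult_right: "a * scale c b = scale c (a * b)"
begin

abbreviation "eval a \<equiv> lin_ext scale (word_eval a)"

text \<open>Universal property of the free algebra: concatenation of words becomes multiplication of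
  values, and bilinearity extends this to polynomials.\<close>

lemma eval_hom: "unital_alg_hom fscale scale (eval a)"
proof -
  interpret E: Vector_Spaces.linear fscale scale "eval a"
    by (rule linear_lin_ext) unfold_locales
  have E_mon: "eval a (mon u) = word_eval a u" for u
    by (rule lin_ext_mon) unfold_locales
  have "eval a (f * g) = eval a f * eval a g" for f g
  proof (induction f rule: fmon_induct)
    case (mon u)
    show ?case
      by (induction g rule: fmon_induct)
        (simp_all add: mon_mult E_mon E.add E.scale distrib_left fscale_mult_right mult_right)
  qed (simp_all add: distrib_right E.add E.scale fscale_mult_left mult_left)
  moreover have "eval a 1 = 1" by (simp add: E_mon flip: mon_Nil)
  ultimately show ?thesis
    unfolding unital_alg_hom_def by (simp add: E.linear_axioms)
qed

lemma eval_mon: "eval a (mon u) = word_eval a u"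
  by (rule lin_ext_mon) unfold_locales

lemma eval_fvar: "eval a (fvar i) = a i"
  unfolding fvar_def by (simp add: eval_mon)

end

locale alg_hom =
  fixes scale :: "'k::field \<Rightarrow> 'b::ring_1 \<Rightarrow> 'b" and \<phi> :: "'k free_alg \<Rightarrow> 'b"
  assumes hom: "unital_alg_hom fscale scale \<phi>"
begin

sublocale Vector_Spaces.linear fscale scale \<phi>
  using hom by (simp add: unital_alg_hom_def)

lemma mult: "\<phi> (f * g) = \<phi> f * \<phi> g" and one: "\<phi> 1 = 1"
  using hom by (simp_all add: unital_alg_hom_def)

lemma power: "\<phi> (f ^ n) = \<phi> f ^ n"
  by (induction n) (simp_all add: mult one)

lemma commutator: "\<phi> (commutator f g) = commutator (\<phi> f) (\<phi> g)"
  by (simp add: commutator_def diff mult)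

lemma prod_list: "\<phi> (\<Prod>i\<leftarrow>xs. F i) = (\<Prod>i\<leftarrow>xs. \<phi> (F i))"
  by (induction xs) (simp_all add: mult one)

lemma mon: "\<phi> (mon u) = word_eval (\<phi> \<circ> fvar) u"
  by (induction u) (simp_all add: mon_Nil one mon_Cons mult)

end

lemma alg_hom_iff: "alg_hom s \<phi> \<longleftrightarrow> unital_alg_hom fscale s \<phi>"
  by (simp add: alg_hom_def)

lemma unital_alg_hom_comp:
  assumes "unital_alg_hom fscale fscale \<theta>" "unital_alg_hom fscale s \<phi>"
  shows "unital_alg_hom fscale s (\<phi> \<circ> \<theta>)"
  using assms Vector_Spaces.linear_compose[of fscale fscale \<theta> s \<phi>]
  unfolding unital_alg_hom_def by simp

interpretation free_alg: unital_algebra "fscale :: 'k::field \<Rightarrow> _"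
  by unfold_locales (rule fscale_mult_left fscale_mult_right)+

interpretation grassmann: unital_algebra "gscale :: 'k::field \<Rightarrow> _"
  by unfold_locales (rule gscale_mult_left gscale_mult_right)+

section \<open>Centre and commutators of the Grassmann algebra\<close>

lemma centreD: "z \<in> centre \<Longrightarrow> z * a = a * z"
  by (simp add: centre_def)

lemma centreI: "(\<And>a. z * a = a * z) \<Longrightarrow> z \<in> centre"
  by (simp add: centre_def)

lemma centre_mult:
  assumes "y \<in> centre" "z \<in> centre"
  shows "y * z \<in> centre"
proof (rule centreI)
  fix a
  show "y * z * a = a * (y * z)"
    by (metis assms centreD mult.assoc)
qed

lemma centre_prod_list: "(\<And>x. x \<in> set xs \<Longrightarrow> F x \<in> centre) \<Longrightarrow> (\<Prod>x\<leftarrow>xs. F x) \<in> centre"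
  by (induction xs) (simp_all add: centre_mult, simp add: centre_def)

lemma commutator_add_left: "commutator (x + y) z = commutator x z + commutator y z"
  by (simp add: commutator_def algebra_simps)

text \<open>Bracketing with \<open>y\<close> is a derivation; as the commutator is central, the
  usual power rule holds.\<close>

lemma commutator_power:
  assumes "commutator x y \<in> centre"
  shows "commutator (x ^ n) y = of_nat n * x ^ (n - 1) * commutator x y"
proof (induction n)
  case 0
  show ?case by (simp add: commutator_def)
next
  case (Suc n)
  let ?k = "commutator x y"
  have "commutator (x ^ Suc n) y = x * commutator (x ^ n) y + ?k * x ^ n"
    by (simp add: commutator_def algebra_simps)
  also have "?k * x ^ n = x ^ n * ?k"
    using assms by (rule centreD)
  also have "x * commutator (x ^ n) y = of_nat n * (x * x ^ (n - 1)) * ?k"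
    unfolding Suc.IH by (metis mult.assoc mult_of_nat_commute)
  also have "of_nat n * (x * x ^ (n - 1)) = of_nat n * x ^ n"
    by (cases n) simp_all
  finally show ?case by (simp add: distrib_right)
qed

section \<open>Signs, parity and the centre of G\<close>

lemma gsign_mult_gsign:
  assumes "finite A" "finite B" "A \<inter> B = {}"
  shows "gsign A B * gsign B A = ((- 1) ^ (card A * card B) :: 'k::comm_ring_1)"
proof -
  let ?I = "\<lambda>A B. {(a, b). a \<in> A \<and> b \<in> B \<and> b < (a::nat)}"
  have "card (?I B A) = card (prod.swap ` ?I B A)"
    by (rule card_image[symmetric]) (simp add: inj_on_def)
  moreover have "card (?I A B) + card (prod.swap ` ?I B A) = card (?I A B \<union> prod.swap ` ?I B A)"
    by (rule card_Un_disjoint[symmetric]) (auto intro!: finite_imageI finite_inversions assms)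
  \<comment> \<open>Each pair in \<open>A \<times> B\<close> is an inversion for exactly one of the
    two orders of the factors.\<close>
  moreover have "?I A B \<union> prod.swap ` ?I B A = A \<times> B"
    using assms(3) by (force simp: image_iff)
  ultimately have "card (?I A B) + card (?I B A) = card A * card B"
    by (simp add: card_cartesian_product)
  then show ?thesis by (simp add: gsign_def flip: power_add)
qed

lemma gsign_square: "gsign A B * gsign A B = (1 :: 'k::comm_ring_1)"
  by (simp add: gsign_def flip: power_add)

lemma gsign_ne_0 [simp]: "gsign A B \<noteq> (0 :: 'k::field)"
  by (simp add: gsign_def)

lemma gsign_commute:
  assumes "finite A" "finite B" "A \<inter> B = {}"
  shows "gsign A B = (- 1) ^ (card A * card B) * (gsign B A :: 'k::comm_ring_1)"
  unfolding gsign_mult_gsign[OF assms, symmetric] by (simp add: mult.assoc gsign_square)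

lemma gcoeff_eqI: "(\<And>A. finite A \<Longrightarrow> gcoeff a A = gcoeff b A) \<Longrightarrow> a = b"
proof (rule gcoeff_inject[THEN iffD1], rule ext)
  fix A
  assume "\<And>A. finite A \<Longrightarrow> gcoeff a A = gcoeff b A"
  then show "gcoeff a A = gcoeff b A"
    using gcoeff[of a] gcoeff[of b] by (cases "finite A") simp_all
qed

text \<open>Reindexing \<open>b * a\<close> by complements in \<open>C\<close> lets both products
  run over the same splittings.\<close>

lemma gcoeff_commutator:
  fixes a b :: "'k::comm_ring_1 grassmann"
  assumes "finite C"
  shows "gcoeff (commutator a b) C =
    (\<Sum>A\<in>Pow C. (gsign A (C - A) - gsign (C - A) A) * gcoeff a A * gcoeff b (C - A))"
proof -
  have "gcoeff (b * a) C = (\<Sum>A\<in>Pow C. gsign (C - A) A * gcoeff b (C - A) * gcoeff a A)"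
    unfolding times_grassmann.rep_eq
    by (rule sum.reindex_bij_witness[of _ "\<lambda>A. C - A" "\<lambda>A. C - A"]) (auto simp: double_diff)
  then have "gcoeff (commutator a b) C =
      (\<Sum>A\<in>Pow C. gsign A (C - A) * gcoeff a A * gcoeff b (C - A) -
        gsign (C - A) A * gcoeff b (C - A) * gcoeff a A)"
    by (simp add: commutator_def minus_grassmann.rep_eq times_grassmann.rep_eq sum_subtractf)
  also have "\<dots> = (\<Sum>A\<in>Pow C. (gsign A (C - A) - gsign (C - A) A) * gcoeff a A * gcoeff b (C - A))"
    by (rule sum.cong) (simp_all add: algebra_simps)
  finally show ?thesis .
qed

text \<open>If \<open>C\<close> has odd size, one of the two parts has even size; so the product of
  the two sizes is even under either alternative.\<close>

lemma gsign_Diff_commute: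
  assumes "finite C" "A \<subseteq> C" "even (card A) \<or> odd (card C)"
  shows "gsign A (C - A) = (gsign (C - A) A :: 'k::comm_ring_1)"
proof -
  have "card C = card A + card (C - A)"
    using assms by (simp add: card_Diff_subset finite_subset card_mono)
  then have "even (card A * card (C - A))" using assms(3) by auto
  then show ?thesis
    using gsign_commute[of A "C - A"] assms by (auto simp: finite_subset)
qed

text \<open>The even part of G, a concrete description of its centre when 2 is invertible. Infinite
  sets have \<open>card\<close> 0 and escape the condition, but their coefficients are 0
  anyway.\<close>

definition geven :: "'k::field grassmann \<Rightarrow> bool"
  where "geven a \<longleftrightarrow> (\<forall>A. odd (card A) \<longrightarrow> gcoeff a A = 0)"

lemma geven_add: "geven a \<Longrightarrow> geven b \<Longrightarrow> geven (a + b)"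
  and geven_diff: "geven a \<Longrightarrow> geven b \<Longrightarrow> geven (a - b)"
  and geven_scale: "geven a \<Longrightarrow> geven (gscale c a)"
  and geven_zero: "geven 0"
  by (auto simp: geven_def plus_grassmann.rep_eq minus_grassmann.rep_eq gscale.rep_eq
      zero_grassmann.rep_eq)

text \<open>In odd degree the two signs in \<open>gcoeff_commutator\<close> agree for every
  splitting, so each term vanishes.\<close>

lemma geven_commutator: "geven (commutator a b)"
  unfolding geven_def
proof (intro allI impI)
  fix C :: "nat set"
  assume "odd (card C)"
  moreover from this have "finite C" by (auto intro: card_ge_0_finite odd_pos)
  ultimately show "gcoeff (commutator a b) C = 0"
    by (auto simp: gcoeff_commutator gsign_Diff_commute intro!: sum.neutral)
qed

lemma geven_imp_centre:
  assumes "geven a"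
  shows "a \<in> centre"
proof (rule centreI)
  fix b
  have "commutator a b = 0"
  proof (rule gcoeff_eqI)
    fix C :: "nat set"
    assume C: "finite C"
    have "(gsign A (C - A) - gsign (C - A) A) * gcoeff a A * gcoeff b (C - A) = 0"
      if "A \<in> Pow C" for A
      using that assms C
      by (cases "even (card A)") (auto simp: geven_def gsign_Diff_commute[of C A])
    then show "gcoeff (commutator a b) C = gcoeff 0 C"
      unfolding gcoeff_commutator[OF C] zero_grassmann.rep_eq by (rule sum.neutral[OF ballI])
  qed
  then show "a * b = b * a" by (simp add: commutator_def)
qed

lemma commutator_centre: "commutator a b \<in> (centre :: 'k::field grassmann set)"
  by (intro geven_imp_centre geven_commutator)

text \<open>Only one splitting of \<open>A \<union> B\<close> has \<open>B\<close> as the prescribed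
  factor, so no cancellation can hide a coefficient of \<open>z\<close>.\<close>

lemma gcoeff_mult_gmonom:
  assumes "finite A" "finite B" "A \<inter> B = {}"
  shows "gcoeff (z * gmonom B) (A \<union> B) = gsign A B * gcoeff z A"
    and "gcoeff (gmonom B * z) (A \<union> B) = gsign B A * gcoeff z A"
proof -
  have [simp]: "A \<union> B - A = B" "A \<union> B - B = A" using assms by auto
  have "gcoeff (z * gmonom B) (A \<union> B) =
      (\<Sum>D\<in>Pow (A \<union> B). if D = A then gsign A B * gcoeff z A else 0)"
    unfolding times_grassmann.rep_eq gmonom.rep_eq using assms by (intro sum.cong) auto
  then show "gcoeff (z * gmonom B) (A \<union> B) = gsign A B * gcoeff z A"
    using assms by simp
  have "gcoeff (gmonom B * z) (A \<union> B) =
      (\<Sum>D\<in>Pow (A \<union> B). if D = B then gsign B A * gcoeff z A else 0)"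
    unfolding times_grassmann.rep_eq gmonom.rep_eq using assms by (intro sum.cong) auto
  then show "gcoeff (gmonom B * z) (A \<union> B) = gsign B A * gcoeff z A"
    using assms by simp
qed

text \<open>Every monomial of \<open>gmonom B * g\<close> contains the nonempty set
  \<open>B\<close>, so a second factor \<open>gmonom B\<close> kills it. Perturbations by such
  monomials therefore have no terms of second order.\<close>

lemma gmonom_sandwich:
  assumes "B \<noteq> {}"
  shows "gmonom B * g * gmonom B = 0"
proof (rule gcoeff_eqI)
  fix C :: "nat set"
  assume "finite C"
  have left: "gcoeff (gmonom B * g) A = 0" if "\<not> B \<subseteq> A" for A
    unfolding times_grassmann.rep_eq gmonom.rep_eq using that by (intro sum.neutral) auto
  have "gsign A (C - A) * gcoeff (gmonom B * g) A * gcoeff (gmonom B) (C - A) = 0" for A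
    using left[of A] assms by (cases "B \<subseteq> A") (auto simp: gmonom.rep_eq)
  then show "gcoeff (gmonom B * g * gmonom B) C = gcoeff 0 C"
    unfolding times_grassmann.rep_eq[of "gmonom B * g"] zero_grassmann.rep_eq
    by (simp add: sum.neutral)
qed

text \<open>Only finitely many of the infinitely many generators occur in \<open>z\<close>.\<close>

lemma ex_fresh_generators:
  obtains B where "finite B" "card B = n" "\<And>A. gcoeff z A \<noteq> 0 \<Longrightarrow> A \<inter> B = {}"
proof -
  let ?U = "\<Union>{A. gcoeff z A \<noteq> 0}"
  have "finite ?U" using gcoeff[of z] by auto
  then have "infinite (- ?U)" by (simp add: Compl_eq_Diff_UNIV)
  then obtain B where "finite B" "card B = n" "B \<subseteq> - ?U"
    by (meson infinite_arbitrarily_large)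
  then show thesis by (intro that) auto
qed

lemma geven_mult_gmonom_imp_zero:
  assumes "\<And>B. finite B \<Longrightarrow> B \<noteq> {} \<Longrightarrow> geven (z * gmonom B)"
  shows "z = 0"
proof (rule gcoeff_eqI)
  fix A :: "nat set"
  assume A: "finite A"
  show "gcoeff z A = gcoeff 0 A"
  proof (rule ccontr)
    assume "gcoeff z A \<noteq> gcoeff 0 A"
    then have ne: "gcoeff z A \<noteq> 0" by (simp add: zero_grassmann.rep_eq)
    \<comment> \<open>The size of \<open>B\<close> makes \<open>A \<union> B\<close> odd: one fresh
      generator for even \<open>A\<close>, two for odd \<open>A\<close>.\<close>
    obtain B where B: "finite B" "card B = (if even (card A) then 1 else 2)" "A \<inter> B = {}"
      using ex_fresh_generators[of "if even (card A) then 1 else 2" z] ne by metis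
    then have "B \<noteq> {}" "odd (card (A \<union> B))" using A by (auto simp: card_Un_disjoint split: if_splits)
    then have "gcoeff (z * gmonom B) (A \<union> B) = 0" using assms B unfolding geven_def by blast
    then show False
      using ne by (simp add: gcoeff_mult_gmonom(1)[OF A B(1,3)])
  qed
qed

lemma of_nat_grassmann: "of_nat n = gscale (of_nat n) (1 :: 'k::field grassmann)"
  by (induction n) (simp_all add: grassmann.scale_left_distrib)

section \<open>Consequences of characteristic different from 2\<close>

context
  assumes two: "(2 :: 'k::field) \<noteq> 0"
begin

text \<open>An odd monomial anticommutes with a fresh generator, so centrality forces twice its
  coefficient to be 0.\<close>

lemma centre_imp_geven:
  fixes z :: "'k grassmann"
  assumes "z \<in> centre"
  shows "geven z"
  unfolding geven_def
proof (intro allI impI, rule ccontr)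
  fix A :: "nat set"
  assume A: "odd (card A)" and ne: "gcoeff z A \<noteq> 0"
  then have fin: "finite A" by (auto intro: card_ge_0_finite odd_pos)
  obtain B where B: "finite B" "card B = 1" "A \<inter> B = {}"
    using ex_fresh_generators[of 1 z] ne by metis
  have "gsign A B * gcoeff z A = gsign B A * gcoeff z A"
    by (simp only: centreD[OF assms] flip: gcoeff_mult_gmonom[OF fin B(1,3)])
  moreover have "gsign A B = - (gsign B A :: 'k)"
    using gsign_commute[OF fin B(1,3), where 'k = 'k] A B(2) by simp
  ultimately have "2 * (gsign B A * gcoeff z A) = 0" by simp
  then show False using ne two by simp
qed

lemma grassmann_double_eq_0:
  fixes a :: "'k grassmann"
  assumes "a + a = 0"
  shows "a = 0"
proof -
  have "gscale 2 a = a + a" by (metis grassmann.scale_left_distrib grassmann.scale_one one_add_one)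
  with assms two show ?thesis by simp
qed

text \<open>The double commutator \<open>[[x x, z], y]\<close> is 0 because commutators are central;
  expanding it yields twice the product in question.\<close>

lemma commutator_mult_commutator:
  fixes x :: "'k grassmann"
  shows "commutator x y * commutator x z = 0"
proof (rule grassmann_double_eq_0)
  let ?k = "commutator x z"
  have k: "?k * a = a * ?k" for a by (rule centreD[OF commutator_centre])
  have sq: "commutator (x * x) z = x * ?k + x * ?k"
    using k[of x] by (simp add: commutator_def algebra_simps)
  have "commutator (x * ?k) y = x * (?k * y) - y * x * ?k"
    by (simp add: commutator_def mult.assoc)
  also have "\<dots> = commutator x y * ?k"
    unfolding k by (simp add: commutator_def left_diff_distrib mult.assoc)
  finally have "commutator x y * ?k + commutator x y * ?k = commutator (commutator (x * x) z) y"
    unfolding sq commutator_add_left by simp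
  also have "\<dots> = 0"
    using centreD[OF commutator_centre, of "x * x" z y] by (simp add: commutator_def)
  finally show "commutator x y * ?k + commutator x y * ?k = 0" .
qed

end

section \<open>T-spaces\<close>

lemma subspace_T_space_gen: "free_alg.subspace (T_space_gen Y)"
  using T_space_T_space_gen unfolding T_space_def by blast

lemma T_space_gen_hom:
  assumes "y \<in> Y" "unital_alg_hom fscale fscale \<theta>"
  shows "\<theta> y \<in> T_space_gen Y"
  using assms T_space_T_space_gen[of Y] T_space_gen_superset[of Y] unfolding T_space_def by blast

lemma commutator_mem_T_space_gen:
  assumes "commutator (fvar 1) (fvar 2) \<in> Y"
  shows "commutator f g \<in> T_space_gen Y"
proof -
  let ?a = "\<lambda>i. if i = 1 then f else g"
  interpret alg_hom fscale "free_alg.eval ?a" by unfold_locales (rule free_alg.eval_hom)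
  have "free_alg.eval ?a (commutator (fvar 1) (fvar 2)) \<in> T_space_gen Y"
    by (intro T_space_gen_hom assms hom)
  then show ?thesis unfolding commutator free_alg.eval_fvar by simp
qed

lemma T_GI:
  fixes f :: "'k::field free_alg"
  assumes "\<And>\<phi> :: 'k free_alg \<Rightarrow> 'k grassmann. alg_hom gscale \<phi> \<Longrightarrow> \<phi> f = 0"
  shows "f \<in> T_G"
  using assms unfolding T_G_def by (simp add: alg_hom_iff)

lemma T_GD:
  fixes \<phi> :: "'k::field free_alg \<Rightarrow> 'k grassmann"
  assumes "f \<in> T_G" "alg_hom gscale \<phi>"
  shows "\<phi> f = 0"
  using assms unfolding T_G_def by (simp add: alg_hom_iff)

lemma T_G_mult_right:
  fixes f :: "'k::field free_alg"
  assumes "f \<in> T_G"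
  shows "f * g \<in> T_G"
proof (rule T_GI)
  fix \<phi> :: "'k free_alg \<Rightarrow> 'k grassmann"
  assume \<phi>: "alg_hom gscale \<phi>"
  then interpret alg_hom gscale \<phi> .
  show "\<phi> (f * g) = 0" using T_GD[OF assms \<phi>] by (simp add: mult)
qed

lemma subspace_T_G: "free_alg.subspace (T_G :: 'k::field free_alg set)"
proof (rule free_alg.subspaceI)
  show "0 \<in> (T_G :: 'k free_alg set)"
  proof (rule T_GI)
    fix \<phi> :: "'k free_alg \<Rightarrow> 'k grassmann" assume "alg_hom gscale \<phi>"
    then interpret alg_hom gscale \<phi> .
    show "\<phi> 0 = 0" by (rule zero)
  qed
next
  fix f g :: "'k free_alg" assume fg: "f \<in> T_G" "g \<in> T_G"
  show "f + g \<in> T_G"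
  proof (rule T_GI)
    fix \<phi> :: "'k free_alg \<Rightarrow> 'k grassmann" assume \<phi>: "alg_hom gscale \<phi>"
    then interpret alg_hom gscale \<phi> .
    show "\<phi> (f + g) = 0" using fg[THEN T_GD, OF \<phi>] by (simp add: add)
  qed
next
  fix f :: "'k free_alg" and c assume f: "f \<in> T_G"
  show "fscale c f \<in> T_G"
  proof (rule T_GI)
    fix \<phi> :: "'k free_alg \<Rightarrow> 'k grassmann" assume \<phi>: "alg_hom gscale \<phi>"
    then interpret alg_hom gscale \<phi> .
    show "\<phi> (fscale c f) = 0" using T_GD[OF f \<phi>] by (simp add: scale)
  qed
qed

text \<open>Unlike the set of central polynomials, this is itself a T-space. Both sides of the
  theorem are shown to equal it.\<close>

definition central_valued :: "'k::field free_alg set"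
  where "central_valued = {f. \<forall>\<phi> :: 'k free_alg \<Rightarrow> 'k grassmann. alg_hom gscale \<phi> \<longrightarrow> \<phi> f \<in> centre}"

lemma central_valuedD: "f \<in> central_valued \<Longrightarrow> alg_hom gscale \<phi> \<Longrightarrow> \<phi> f \<in> centre"
  by (simp add: central_valued_def)

lemma subspace_centre: "grassmann.subspace (centre :: 'k::field grassmann set)"
  by (rule grassmann.subspaceI)
    (auto simp: centre_def algebra_simps gscale_mult_left gscale_mult_right)

lemma T_space_central_valued: "T_space (central_valued :: 'k::field free_alg set)"
proof -
  have "free_alg.subspace (central_valued :: 'k free_alg set)"
  proof (rule free_alg.subspaceI)
    show "0 \<in> (central_valued :: 'k free_alg set)"
      unfolding central_valued_def
    proof (intro CollectI allI impI)
      fix \<phi> :: "'k free_alg \<Rightarrow> 'k grassmann" assume "alg_hom gscale \<phi>"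
      then interpret alg_hom gscale \<phi> .
      show "\<phi> 0 \<in> centre" by (simp add: zero grassmann.subspace_0[OF subspace_centre])
    qed
  next
    fix f g :: "'k free_alg" assume fg: "f \<in> central_valued" "g \<in> central_valued"
    show "f + g \<in> central_valued"
      unfolding central_valued_def
    proof (intro CollectI allI impI)
      fix \<phi> :: "'k free_alg \<Rightarrow> 'k grassmann" assume \<phi>: "alg_hom gscale \<phi>"
      then interpret alg_hom gscale \<phi> .
      show "\<phi> (f + g) \<in> centre"
        using fg[THEN central_valuedD, OF \<phi>] by (simp add: add grassmann.subspace_add[OF subspace_centre])
    qed
  next
    fix f :: "'k free_alg" and c assume f: "f \<in> central_valued"
    show "fscale c f \<in> central_valued"
      unfolding central_valued_def
    proof (intro CollectI allI impI)
      fix \<phi> :: "'k free_alg \<Rightarrow> 'k grassmann" assume \<phi>: "alg_hom gscale \<phi>"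
      then interpret alg_hom gscale \<phi> .
      show "\<phi> (fscale c f) \<in> centre"
        using central_valuedD[OF f \<phi>] by (simp add: scale grassmann.subspace_scale[OF subspace_centre])
    qed
  qed
  moreover have "\<theta> f \<in> central_valued"
    if "f \<in> central_valued" "unital_alg_hom fscale fscale \<theta>" for f :: "'k free_alg" and \<theta>
    using that unital_alg_hom_comp[OF that(2)] unfolding central_valued_def alg_hom_iff by fastforce
  ultimately show ?thesis unfolding T_space_def by blast
qed

lemma T_G_subset_central_valued: "T_G \<subseteq> central_valued"
  using grassmann.subspace_0[OF subspace_centre]
  by (auto simp: central_valued_def T_GD)

lemma S1_plus_T_G_subspace: "free_alg.subspace (S1 p + T_G)"
proof -
  have sum: "free_alg.subspace (A + B)" if "free_alg.subspace A" "free_alg.subspace B" for A B :: "'a free_alg set"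
  proof -
    have "A + B = {x + y | x y. x \<in> A \<and> y \<in> B}" by (auto simp: set_plus_def)
    then show ?thesis using free_alg.subspace_sums[OF that] by simp
  qed
  show ?thesis
    unfolding S1_def by (intro sum subspace_T_space_gen subspace_T_G)
qed

lemma S1_subset_S1_plus_T_G: "S1 p \<subseteq> S1 p + T_G"
  unfolding add.commute[of "S1 p" T_G]
  by (rule set_zero_plus2[OF free_alg.subspace_0[OF subspace_T_G]])

lemma T_space_gen_subset_S1:
  "T_space_gen {commutator (fvar 1) (fvar 2), fvar 1 ^ p} \<subseteq> S1 p"
  "T_space_gen {fvar 1 ^ p * (\<Prod>i\<leftarrow>[1..<n+1].
        commutator (fvar (2*i)) (fvar (2*i+1)) * fvar (2*i) ^ (p-1) * fvar (2*i+1) ^ (p-1)) | n. n \<ge> 1}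
    \<subseteq> S1 p"
  unfolding S1_def
  by (subst add.commute, rule set_zero_plus2[OF free_alg.subspace_0[OF subspace_T_space_gen]])
    (rule set_zero_plus2[OF free_alg.subspace_0[OF subspace_T_space_gen]])

lemma T_G_subset_S1_plus_T_G: "T_G \<subseteq> S1 p + T_G"
proof (rule set_zero_plus2)
  show "0 \<in> S1 p"
    using T_space_gen_subset_S1(1) free_alg.subspace_0[OF subspace_T_space_gen] by blast
qed

section \<open>Central polynomials\<close>

text \<open>The hypothesis lets \<open>x\<close> move past any \<open>c\<close> next to
  \<open>k\<close>; it is applied with \<open>k\<close> a commutator in which \<open>x\<close>
  occurs.\<close>

lemma centre_mult_power_commute:
  fixes k x :: "'a::ring_1"
  assumes "\<And>c. k * x * c = k * c * x"
  shows "k * x ^ n * c = k * c * x ^ n"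
proof (induction n arbitrary: c)
  case (Suc n)
  have "k * x ^ Suc n * c = k * x * (x ^ n * c)" by (simp add: mult.assoc)
  also have "\<dots> = k * x ^ n * c * x" unfolding assms by (simp add: mult.assoc)
  also have "\<dots> = k * c * x ^ Suc n" unfolding Suc.IH by (simp add: mult.assoc power_commutes)
  finally show ?case .
qed simp

context
  fixes p :: nat
  assumes char: "CHAR('k::field) = p" and p_gt_2: "p > 2"
begin

lemma prime_char: "prime p"
  using prime_CHAR_semidom[where 'a = 'k] char p_gt_2 by simp

lemma two_neq_0: "(2 :: 'k) \<noteq> 0"
  using of_nat_eq_0_iff_char_dvd[of 2, where 'a = 'k] char p_gt_2 by (auto dest: dvd_imp_le)

lemma of_nat_p_grassmann: "of_nat p = (0 :: 'k grassmann)"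
  by (simp add: of_nat_grassmann flip: char)

text \<open>By the power rule, \<open>[x^p, y]\<close> has the factor \<open>of_nat p\<close>, which
  is 0.\<close>

lemma power_p_centre: "(x :: 'k grassmann) ^ p \<in> centre"
proof (rule centreI)
  fix y
  have "commutator (x ^ p) y = 0"
    by (simp add: commutator_power[OF commutator_centre] of_nat_p_grassmann)
  then show "x ^ p * y = y * x ^ p" by (simp add: commutator_def)
qed

text \<open>Since \<open>[x,y][x,c]\<close> and \<open>[y,x][y,c]\<close> vanish, next to
  \<open>[x,y]\<close> both \<open>x\<close> and \<open>y\<close> commute with everything. This
  makes each factor in the generators of \<open>S1\<close> central.\<close>

lemma commutator_mult_powers_centre:
  fixes x y :: "'k grassmann"
  shows "commutator x y * x ^ m * y ^ n \<in> centre"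
proof -
  let ?k = "commutator x y"
  have k: "?k * a = a * ?k" for a by (rule centreD[OF commutator_centre])
  have x: "?k * x * c = ?k * c * x" for c
    using commutator_mult_commutator[OF two_neq_0, of x y c]
    by (simp add: commutator_def[of x c] right_diff_distrib mult.assoc)
  have neg: "commutator y x = - ?k" by (simp add: commutator_def)
  have y: "?k * y * c = ?k * c * y" for c
    using commutator_mult_commutator[OF two_neq_0, of y x c] unfolding neg
    by (simp add: commutator_def[of y c] right_diff_distrib mult.assoc)
  show ?thesis
  proof (rule centreI)
    fix c
    have "?k * x ^ m * y ^ n * c = ?k * x ^ m * (y ^ n * c)" by (simp add: mult.assoc)
    also have "\<dots> = ?k * y ^ n * c * x ^ m"
      unfolding centre_mult_power_commute[OF x] by (simp add: mult.assoc)
    also have "\<dots> = ?k * (c * y ^ n) * x ^ m"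
      unfolding centre_mult_power_commute[OF y] by (simp add: mult.assoc)
    also have "\<dots> = ?k * x ^ m * (c * y ^ n)"
      by (rule centre_mult_power_commute[OF x, symmetric])
    also have "\<dots> = ?k * x ^ m * c * y ^ n" by (simp add: mult.assoc)
    also have "\<dots> = ?k * c * x ^ m * y ^ n"
      unfolding centre_mult_power_commute[OF x] ..
    finally show "?k * x ^ m * y ^ n * c = c * (?k * x ^ m * y ^ n)"
      by (simp add: k mult.assoc)
  qed
qed

lemma commutator_central_valued: "commutator f g \<in> (central_valued :: 'k free_alg set)"
  unfolding central_valued_def
proof (intro CollectI allI impI)
  fix \<phi> :: "'k free_alg \<Rightarrow> 'k grassmann" assume \<phi>: "alg_hom gscale \<phi>"
  then interpret alg_hom gscale \<phi> .
  show "\<phi> (commutator f g) \<in> centre" unfolding commutator by (rule commutator_centre)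
qed

lemma power_p_central_valued: "f ^ p \<in> (central_valued :: 'k free_alg set)"
  unfolding central_valued_def
proof (intro CollectI allI impI)
  fix \<phi> :: "'k free_alg \<Rightarrow> 'k grassmann" assume \<phi>: "alg_hom gscale \<phi>"
  then interpret alg_hom gscale \<phi> .
  show "\<phi> (f ^ p) \<in> centre" unfolding power by (rule power_p_centre)
qed

lemma S1_generator_central_valued:
  "f ^ p * (\<Prod>i\<leftarrow>xs. commutator (F i) (H i) * F i ^ (p-1) * H i ^ (p-1))
    \<in> (central_valued :: 'k free_alg set)"
  unfolding central_valued_def
proof (intro CollectI allI impI)
  fix \<phi> :: "'k free_alg \<Rightarrow> 'k grassmann" assume \<phi>: "alg_hom gscale \<phi>"
  then interpret alg_hom gscale \<phi> .
  show "\<phi> (f ^ p * (\<Prod>i\<leftarrow>xs. commutator (F i) (H i) * F i ^ (p-1) * H i ^ (p-1))) \<in> centre"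
    unfolding mult prod_list power commutator
    by (intro centre_mult[OF power_p_centre] centre_prod_list commutator_mult_powers_centre)
qed

lemma S1_plus_T_G_subset_central_valued: "S1 p + T_G \<subseteq> (central_valued :: 'k free_alg set)"
proof -
  note T = T_space_central_valued[where 'k = 'k]
  have sub: "free_alg.subspace (central_valued :: 'k free_alg set)"
    using T by (simp add: T_space_def)
  have "T_space_gen {commutator (fvar 1) (fvar 2), fvar 1 ^ p} \<subseteq> (central_valued :: 'k free_alg set)"
    by (rule T_space_gen_least[OF T]) (use commutator_central_valued power_p_central_valued in blast)
  moreover have "T_space_gen {fvar 1 ^ p * (\<Prod>i\<leftarrow>[1..<n+1].
        commutator (fvar (2*i)) (fvar (2*i+1)) * fvar (2*i) ^ (p-1) * fvar (2*i+1) ^ (p-1)) | n. n \<ge> 1}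
      \<subseteq> (central_valued :: 'k free_alg set)"
    using S1_generator_central_valued[of "fvar 1" "\<lambda>i. fvar (2*i)" "\<lambda>i. fvar (2*i+1)"]
    by (intro T_space_gen_least[OF T]) blast
  ultimately show ?thesis
    using T_G_subset_central_valued unfolding S1_def
    by (blast elim!: set_plus_elim intro: free_alg.subspace_add[OF sub])
qed

text \<open>A central-valued \<open>f\<close> may fail to be a central polynomial by having a
  constant term or by being an identity. The first is cured by subtracting a constant, the second by
  adding \<open>[x_1,x_2]\<close>; both corrections lie in \<open>CP_G\<close>.\<close>

lemma central_valued_subset_CP_G: "central_valued \<subseteq> (CP_G :: 'k free_alg set)"
proof
  fix f :: "'k free_alg"
  assume f: "f \<in> central_valued"
  have sub: "free_alg.subspace (central_valued :: 'k free_alg set)"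
    using T_space_central_valued[where 'k = 'k] by (simp add: T_space_def)
  have sub': "free_alg.subspace (CP_G :: 'k free_alg set)"
    unfolding CP_G_def by (rule subspace_T_space_gen)
  have central: "g \<in> CP_G" if "g \<in> central_valued" "g \<in> nonunitary" "g \<notin> T_G" for g :: "'k free_alg"
    using that T_space_gen_superset[of "{f. central_polynomial f}"]
    unfolding CP_G_def central_polynomial_def central_valued_def alg_hom_iff by blast
  let ?c = "commutator (fvar 1) (fvar 2) :: 'k free_alg"
  have c_nonunitary: "?c \<in> nonunitary"
    by (simp add: nonunitary_def commutator_def fvar_def mon_mult lookup_minus lookup_single zero_fmon_def)
  \<comment> \<open>Sending each letter to the generator of G with the same index turns the
    commutator into \<open>2 e_1 e_2\<close>.\<close>
  have c_not_T_G: "?c \<notin> T_G"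
  proof
    assume "?c \<in> T_G"
    moreover have ev: "alg_hom gscale (grassmann.eval ggen :: 'k free_alg \<Rightarrow> 'k grassmann)"
      by unfold_locales (rule grassmann.eval_hom)
    ultimately have "grassmann.eval ggen ?c = (0 :: 'k grassmann)" by (rule T_GD)
    then have "ggen 1 * ggen 2 - ggen 2 * ggen 1 = (0 :: 'k grassmann)"
      unfolding alg_hom.commutator[OF ev] grassmann.eval_fvar by (simp only: commutator_def)
    then have "ggen 1 * ggen 2 + ggen 1 * ggen 2 = (0 :: 'k grassmann)"
      unfolding ggen_anticommute[of 2 1] diff_minus_eq_add .
    then have "ggen 1 * ggen 2 = (0 :: 'k grassmann)"
      by (rule grassmann_double_eq_0[OF two_neq_0])
    moreover have "gcoeff (ggen 1 * ggen 2) ({1} \<union> {2}) = (gsign {1} {2} * gcoeff (ggen 1) {1} :: 'k)"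
      unfolding ggen_def[of 2] by (rule gcoeff_mult_gmonom) auto
    ultimately show False by (simp add: zero_grassmann.rep_eq ggen_def gmonom.rep_eq)
  qed
  have c: "?c \<in> CP_G"
    by (intro central commutator_central_valued c_nonunitary c_not_T_G)
  have pow: "fvar 1 ^ p \<in> (CP_G :: 'k free_alg set)"
  proof (intro central power_p_central_valued)
    have "(fvar 1 :: 'k free_alg) ^ n = mon (replicate n 1)" for n
      by (induction n) (simp_all add: mon_Nil mon_Cons)
    then show "(fvar 1 :: 'k free_alg) ^ p \<in> nonunitary"
      using p_gt_2 by (simp add: nonunitary_def lookup_single zero_fmon_def)
    have ev: "alg_hom gscale (grassmann.eval (\<lambda>_. 1) :: 'k free_alg \<Rightarrow> 'k grassmann)"
      by unfold_locales (rule grassmann.eval_hom)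
    show "(fvar 1 :: 'k free_alg) ^ p \<notin> T_G"
      using T_GD[OF _ ev, of "fvar 1 ^ p"] by (auto simp: alg_hom.power[OF ev] grassmann.eval_fvar)
  qed
  have one: "1 \<in> (CP_G :: 'k free_alg set)"
  proof -
    \<comment> \<open>Sending every letter to 1 is an endomorphism, so the T-space contains the
      image 1 of \<open>x_1^p\<close>.\<close>
    have ev: "alg_hom fscale (free_alg.eval (\<lambda>_. 1) :: 'k free_alg \<Rightarrow> 'k free_alg)"
      by unfold_locales (rule free_alg.eval_hom)
    have "free_alg.eval (\<lambda>_. 1) (fvar 1 ^ p) \<in> (CP_G :: 'k free_alg set)"
      using pow ev T_space_T_space_gen[of "{f :: 'k free_alg. central_polynomial f}"]
      unfolding CP_G_def T_space_def alg_hom_iff by blast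
    then show ?thesis by (simp add: alg_hom.power[OF ev] free_alg.eval_fvar)
  qed
  let ?u = "fscale (Poly_Mapping.lookup f 0) 1"
  let ?g = "f - ?u"
  have "1 \<in> (central_valued :: 'k free_alg set)" using power_p_central_valued[of 1] by simp
  then have g: "?g \<in> central_valued"
    using f by (intro free_alg.subspace_diff[OF sub] free_alg.subspace_scale[OF sub])
  have g_nonunitary: "?g \<in> nonunitary"
    by (simp add: nonunitary_def lookup_minus lookup_fscale)
  have "?g \<in> CP_G"
  proof (cases "?g \<in> T_G")
    case True
    have "?g + ?c \<in> CP_G"
    proof (intro central)
      show "?g + ?c \<in> central_valued"
        by (intro free_alg.subspace_add[OF sub] g commutator_central_valued)
      show "?g + ?c \<in> nonunitary"
        using c_nonunitary g_nonunitary by (simp add: nonunitary_def lookup_add)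
      show "?g + ?c \<notin> T_G"
        using True c_not_T_G free_alg.subspace_diff[OF subspace_T_G, of "?g + ?c" ?g] by auto
    qed
    from free_alg.subspace_diff[OF sub' this c] show ?thesis by simp
  next
    case False
    then show ?thesis by (intro central g g_nonunitary)
  qed
  from free_alg.subspace_add[OF sub' this free_alg.subspace_scale[OF sub' one, of "Poly_Mapping.lookup f 0"]]
  show "f \<in> CP_G" by simp
qed

end

lemma CP_G_subset_central_valued: "CP_G \<subseteq> central_valued"
  unfolding CP_G_def
  by (rule T_space_gen_least[OF T_space_central_valued])
    (auto simp: central_polynomial_def central_valued_def alg_hom_iff)

section \<open>Euler operators and cyclic derivatives\<close>

fun splits :: "nat \<Rightarrow> nat list \<Rightarrow> (nat list \<times> nat list) list"
  where
    "splits i [] = []"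
  | "splits i (j # w) =
      (if j = i then [([], w)] else []) @ map (\<lambda>(u, v). (j # u, v)) (splits i w)"

lemma splits_sound: "(u, v) \<in> set (splits i w) \<Longrightarrow> w = u @ i # v"
  by (induction w arbitrary: u) (auto split: if_splits)

lemma length_splits: "length (splits i w) = count_list w i"
  by (induction w) auto

definition euler :: "nat \<Rightarrow> 'k::field free_alg \<Rightarrow> 'k free_alg"
  where "euler i = lin_ext fscale (\<lambda>w. fscale (of_nat (count_list w i)) (mon w))"

definition cyclic_deriv :: "nat \<Rightarrow> 'k::field free_alg \<Rightarrow> 'k free_alg"
  where "cyclic_deriv i = lin_ext fscale (\<lambda>w. \<Sum>(u, v)\<leftarrow>splits i w. mon (v @ u))"

lemma linear_euler: "Vector_Spaces.linear fscale fscale (euler i)"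
  unfolding euler_def by (rule linear_lin_ext) unfold_locales

lemma linear_cyclic_deriv: "Vector_Spaces.linear fscale fscale (cyclic_deriv i)"
  unfolding cyclic_deriv_def by (rule linear_lin_ext) unfold_locales

lemma euler_mon: "euler i (mon w) = fscale (of_nat (count_list w i)) (mon w)"
  unfolding euler_def by (rule lin_ext_mon) unfold_locales

lemma cyclic_deriv_mon: "cyclic_deriv i (mon w) = (\<Sum>(u, v)\<leftarrow>splits i w. mon (v @ u))"
  unfolding cyclic_deriv_def by (rule lin_ext_mon) unfold_locales

lemma lookup_euler:
  "Poly_Mapping.lookup (euler i f) w = of_nat (count_list (letters w) i) * Poly_Mapping.lookup f w"
proof (induction f rule: fmon_induct)
  case (mon u)
  show ?case by (auto simp: euler_mon lookup_fscale lookup_single when_def)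
next
  case (add f g)
  interpret E: Vector_Spaces.linear fscale fscale "euler i" by (rule linear_euler)
  from add show ?case by (simp add: E.add lookup_add algebra_simps)
next
  case (scale c f)
  interpret E: Vector_Spaces.linear fscale fscale "euler i" by (rule linear_euler)
  from scale show ?case by (simp add: E.scale lookup_fscale)
qed

lemma lookup_euler_funpow:
  "Poly_Mapping.lookup ((euler i ^^ n) f) w =
    of_nat (count_list (letters w) i) ^ n * Poly_Mapping.lookup f w"
  by (induction n) (simp_all add: lookup_euler mult.assoc)

text \<open>Every occurrence of \<open>x\<^sub>i\<close> in a word can be rotated to the end modulo commutators.\<close>

lemma euler_minus_cyclic_deriv:
  fixes V :: "'k::field free_alg set"
  assumes V: "free_alg.subspace V" and comm: "\<And>f g. commutator f g \<in> V"
  shows "euler i f - cyclic_deriv i f * fvar i \<in> V"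
proof (induction f rule: fmon_induct)
  case (mon w)
  have "mon w - mon (v @ u) * fvar i \<in> V" if "(u, v) \<in> set (splits i w)" for u v
  proof -
    \<comment> \<open>Here \<open>w\<close> is \<open>u x_i v\<close>, and rotating \<open>v\<close>
      to the front costs one commutator.\<close>
    have "mon w - mon (v @ u) * fvar i = (commutator (mon (u @ [i])) (mon v) :: 'k free_alg)"
      using splits_sound[OF that] by (simp add: commutator_def fvar_def mon_mult)
    then show ?thesis by (simp only: comm)
  qed
  then have "(\<Sum>(u, v)\<leftarrow>xs. mon w - mon (v @ u) * fvar i) \<in> V"
    if "set xs \<subseteq> set (splits i w)" for xs
    using that
    by (induction xs) (auto intro: free_alg.subspace_0[OF V] free_alg.subspace_add[OF V])
  \<comment> \<open>For \<open>xs = splits i w\<close> the length is the degree in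
    \<open>x_i\<close>, so the first term becomes the Euler operator.\<close>
  moreover have "(\<Sum>(u, v)\<leftarrow>xs. mon w - mon (v @ u) * fvar i) =
      fscale (of_nat (length xs)) (mon w) - (\<Sum>(u, v)\<leftarrow>xs. mon (v @ u)) * (fvar i :: 'k free_alg)" for xs
    by (induction xs) (auto simp: free_alg.scale_left_distrib distrib_right)
  ultimately show ?case
    by (metis cyclic_deriv_mon euler_mon length_splits order_refl)
next
  case (add f g)
  interpret E: Vector_Spaces.linear fscale fscale "euler i" by (rule linear_euler)
  interpret D: Vector_Spaces.linear fscale fscale "cyclic_deriv i" by (rule linear_cyclic_deriv)
  have "euler i (f + g) - cyclic_deriv i (f + g) * fvar i =
      (euler i f - cyclic_deriv i f * fvar i) + (euler i g - cyclic_deriv i g * fvar i)"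
    by (simp add: E.add D.add distrib_right)
  with add show ?case by (simp only: free_alg.subspace_add[OF V])
next
  case (scale c f)
  interpret E: Vector_Spaces.linear fscale fscale "euler i" by (rule linear_euler)
  interpret D: Vector_Spaces.linear fscale fscale "cyclic_deriv i" by (rule linear_cyclic_deriv)
  have "euler i (fscale c f) - cyclic_deriv i (fscale c f) * fvar i =
      fscale c (euler i f - cyclic_deriv i f * fvar i)"
    by (simp add: E.scale D.scale fscale_mult_left free_alg.scale_right_diff_distrib)
  with scale show ?case by (simp only: free_alg.subspace_scale[OF V])
qed

text \<open>Expanding the product, all terms with at least two factors \<open>h\<close> contain some
  \<open>h * g * h\<close>; only the terms linear in \<open>h\<close> remain.\<close>

lemma word_eval_perturb:
  fixes h :: "'b::ring_1"
  assumes sandwich: "\<And>g. h * g * h = 0"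
  shows "word_eval (a(i := a i + h)) w =
    word_eval a w + (\<Sum>(u, v)\<leftarrow>splits i w. word_eval a u * h * word_eval a v)"
proof (induction w)
  case Nil
  show ?case by simp
next
  case (Cons j w)
  let ?S = "\<Sum>(u, v)\<leftarrow>splits i w. word_eval a u * h * word_eval a v"
  \<comment> \<open>This settles \<open>j = i\<close>, where the new \<open>h\<close> meets the part
    of the tail that is already linear in \<open>h\<close>.\<close>
  have "h * (word_eval a u * h * word_eval a v) = 0" for u v
    using sandwich[of "word_eval a u"] by (simp flip: mult.assoc)
  then have "h * (\<Sum>(u, v)\<leftarrow>xs. word_eval a u * h * word_eval a v) = 0" for xs
    by (induction xs) (auto simp: distrib_left)
  moreover have "(\<Sum>(u, v)\<leftarrow>map (\<lambda>(u, v). (j # u, v)) xs. word_eval a u * h * word_eval a v) =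
      a j * (\<Sum>(u, v)\<leftarrow>xs. word_eval a u * h * word_eval a v)" for xs
    by (induction xs) (auto simp: distrib_left mult.assoc)
  ultimately show ?case
    by (cases "j = i")
      (simp_all add: Cons.IH distrib_left distrib_right del: fun_upd_apply add: fun_upd_same fun_upd_other)
qed

lemma cyclic_deriv_mem_T_G:
  fixes f :: "'k::field free_alg"
  assumes f: "f \<in> central_valued" and two: "(2 :: 'k) \<noteq> 0"
  shows "cyclic_deriv i f \<in> T_G"
proof (rule T_GI)
  fix \<phi> :: "'k free_alg \<Rightarrow> 'k grassmann"
  assume \<phi>: "alg_hom gscale \<phi>"
  then interpret \<phi>: alg_hom gscale \<phi> .
  interpret D: Vector_Spaces.linear fscale fscale "cyclic_deriv i" by (rule linear_cyclic_deriv)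
  show "\<phi> (cyclic_deriv i f) = 0"
  proof (rule geven_mult_gmonom_imp_zero)
    fix B :: "nat set"
    assume B: "finite B" "B \<noteq> {}"
    define h :: "'k grassmann" where "h = gmonom B"
    define a where "a = \<phi> \<circ> fvar"
    \<comment> \<open>\<open>\<psi>\<close> is \<open>\<phi>\<close> with the value of
      \<open>x_i\<close> shifted by \<open>h\<close>.\<close>
    define \<psi> where "\<psi> = grassmann.eval (a(i := a i + h))"
    have \<psi>: "alg_hom gscale \<psi>"
      unfolding \<psi>_def by unfold_locales (rule grassmann.eval_hom)
    interpret \<psi>: alg_hom gscale \<psi> by (rule \<psi>)
    have deriv: "geven (\<psi> g - \<phi> g - \<phi> (cyclic_deriv i g) * h)" for g
    proof (induction g rule: fmon_induct)
      case (mon w)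
      let ?e = "word_eval a"
      have sandwich: "h * g * h = 0" for g
        unfolding h_def by (rule gmonom_sandwich[OF B(2)])
      have "\<psi> (mon w) - \<phi> (mon w) = (\<Sum>(u, v)\<leftarrow>splits i w. ?e u * h * ?e v)"
        unfolding \<psi>_def grassmann.eval_mon word_eval_perturb[OF sandwich] by (simp add: \<phi>.mon a_def)
      moreover have "\<phi> (\<Sum>(u, v)\<leftarrow>xs. mon (v @ u)) = (\<Sum>(u, v)\<leftarrow>xs. ?e v * ?e u)" for xs
        by (induction xs) (auto simp: \<phi>.add \<phi>.mon simp flip: a_def)
      then have "\<phi> (cyclic_deriv i (mon w)) = (\<Sum>(u, v)\<leftarrow>splits i w. ?e v * ?e u)"
        by (simp only: cyclic_deriv_mon)
      moreover have "geven ((\<Sum>(u, v)\<leftarrow>xs. ?e u * h * ?e v) - (\<Sum>(u, v)\<leftarrow>xs. ?e v * ?e u) * h)" for xs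
      proof (induction xs)
        case Nil
        show ?case by (simp add: geven_zero)
      next
        case (Cons x xs)
        obtain u v where x: "x = (u, v)" by (cases x)
        \<comment> \<open>Moving \<open>v\<close> to the front of \<open>u h v\<close> changes it by
          a commutator, which is even.\<close>
        have "(\<Sum>(u, v)\<leftarrow>x # xs. ?e u * h * ?e v) - (\<Sum>(u, v)\<leftarrow>x # xs. ?e v * ?e u) * h =
            ((\<Sum>(u, v)\<leftarrow>xs. ?e u * h * ?e v) - (\<Sum>(u, v)\<leftarrow>xs. ?e v * ?e u) * h)
            + commutator (?e u * h) (?e v)"
          by (simp add: x commutator_def algebra_simps)
        then show ?case by (simp only: geven_add Cons.IH geven_commutator)
      qed
      ultimately show ?case by simp
    next
      case (add f g)
      have "\<psi> (f + g) - \<phi> (f + g) - \<phi> (cyclic_deriv i (f + g)) * h =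
          (\<psi> f - \<phi> f - \<phi> (cyclic_deriv i f) * h) + (\<psi> g - \<phi> g - \<phi> (cyclic_deriv i g) * h)"
        by (simp add: \<psi>.add \<phi>.add D.add distrib_right)
      with add show ?case by (simp only: geven_add)
    next
      case (scale c f)
      have "\<psi> (fscale c f) - \<phi> (fscale c f) - \<phi> (cyclic_deriv i (fscale c f)) * h =
          gscale c (\<psi> f - \<phi> f - \<phi> (cyclic_deriv i f) * h)"
        by (simp add: \<psi>.scale \<phi>.scale D.scale gscale_mult_left grassmann.scale_right_diff_distrib)
      with scale show ?case by (simp only: geven_scale)
    qed
    have "geven (\<psi> f)" "geven (\<phi> f)"
      using centre_imp_geven[OF two] central_valuedD[OF f] \<phi> \<psi> by blast+
    \<comment> \<open>Both values of \<open>f\<close> are even, so subtracting the even error term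
      isolates the product of \<open>\<phi> (cyclic_deriv i f)\<close> with
      \<open>h\<close>.\<close>
    from geven_diff[OF geven_diff[OF this] deriv]
    have "geven ((\<psi> f - \<phi> f) - (\<psi> f - \<phi> f - \<phi> (cyclic_deriv i f) * h))" .
    then show "geven (\<phi> (cyclic_deriv i f) * gmonom B)" by (simp add: h_def)
  qed
qed

section \<open>Reduction to words whose degrees are divisible by \<open>p\<close>\<close>

context
  fixes p :: nat
  assumes char: "CHAR('k::field) = p" and p_gt_2: "p > 2"
begin

text \<open>Commutators in \<open>S1 p\<close> absorb the difference from
  \<open>cyclic_deriv i f * fvar i\<close>, and that product is an identity of G.\<close>

lemma euler_central_valued:
  fixes f :: "'k free_alg"
  assumes "f \<in> central_valued"
  shows "euler i f \<in> S1 p + T_G"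
proof -
  note sub = S1_plus_T_G_subspace[of p, where 'a = 'k]
  have "commutator g h \<in> S1 p + T_G" for g h :: "'k free_alg"
    using commutator_mem_T_space_gen[of "{commutator (fvar 1) (fvar 2), fvar 1 ^ p}" g h]
      T_space_gen_subset_S1(1) S1_subset_S1_plus_T_G by blast
  then have "euler i f - cyclic_deriv i f * fvar i \<in> S1 p + T_G"
    by (rule euler_minus_cyclic_deriv[OF sub])
  moreover have "cyclic_deriv i f * fvar i \<in> S1 p + T_G"
    using T_G_mult_right[OF cyclic_deriv_mem_T_G[OF assms two_neq_0[OF char p_gt_2]]]
      T_G_subset_S1_plus_T_G by blast
  ultimately have "euler i f - cyclic_deriv i f * fvar i + cyclic_deriv i f * fvar i \<in> S1 p + T_G"
    by (rule free_alg.subspace_add[OF sub])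
  then show ?thesis by simp
qed

lemma of_nat_power_p_minus_1: "(of_nat n :: 'k) ^ (p - 1) = (if p dvd n then 0 else 1)"
proof -
  have prime: "prime CHAR('k)" using prime_char[OF char p_gt_2] char by simp
  \<comment> \<open>The freshman's dream carries the equation from \<open>n\<close> to
    \<open>n + 1\<close>.\<close>
  have "(of_nat n :: 'k) ^ p = of_nat n"
    using p_gt_2 by (induction n) (simp_all add: freshmans_dream[OF prime] flip: char)
  then have "of_nat n * (of_nat n :: 'k) ^ (p - 1) = of_nat n"
    using p_gt_2 by (simp flip: power_Suc)
  moreover have "of_nat n = (0 :: 'k) \<longleftrightarrow> p dvd n"
    using char by (simp add: of_nat_eq_0_iff_char_dvd)
  ultimately show ?thesis using p_gt_2 by (auto simp: power_0_left)
qed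

text \<open>By Fermat's little theorem, \<open>1 - E\<^sub>i\<^bsup>p-1\<^esup>\<close> projects onto the words whose degree in \<open>x\<^sub>i\<close>
  is divisible by \<open>p\<close>.\<close>

lemma central_valued_reduce:
  fixes f :: "'k free_alg"
  assumes "finite I" "f \<in> central_valued"
  obtains g where "f - g \<in> S1 p + T_G"
    "\<And>w. Poly_Mapping.lookup g w =
      (if \<forall>i\<in>I. p dvd count_list (letters w) i then Poly_Mapping.lookup f w else 0)"
proof -
  note sub = S1_plus_T_G_subspace[of p, where 'a = 'k]
  have subset: "S1 p + T_G \<subseteq> (central_valued :: 'k free_alg set)"
    by (rule S1_plus_T_G_subset_central_valued[OF char p_gt_2])
  have sub': "free_alg.subspace (central_valued :: 'k free_alg set)"
    using T_space_central_valued[where 'k = 'k] by (simp add: T_space_def)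
  \<comment> \<open>Centrality of \<open>g\<close> is part of the claim because the Euler operator
    of the next letter is applied to \<open>g\<close>.\<close>
  have "\<exists>g\<in>central_valued. f - g \<in> S1 p + T_G \<and> (\<forall>w. Poly_Mapping.lookup g w =
      (if \<forall>i\<in>I. p dvd count_list (letters w) i then Poly_Mapping.lookup f w else 0))"
    using assms(1)
  proof (induction I)
    case empty
    show ?case using assms(2) free_alg.subspace_0[OF sub] by (intro bexI[of _ f]) auto
  next
    case (insert i I)
    then obtain g where g: "g \<in> central_valued" "f - g \<in> S1 p + T_G"
      "\<And>w. Poly_Mapping.lookup g w =
        (if \<forall>i\<in>I. p dvd count_list (letters w) i then Poly_Mapping.lookup f w else 0)"
      by blast
    \<comment> \<open>Every application after the first acts on an element of
      \<open>S1 p + T_G\<close>, which is again central-valued. At least one application is needed,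
      hence \<open>Suc n\<close>.\<close>
    have "(euler i ^^ Suc n) g \<in> S1 p + T_G" for n
      using subset g(1) by (induction n) (auto intro: euler_central_valued)
    moreover have "p - 1 = Suc (p - 2)" using p_gt_2 by simp
    ultimately have e: "(euler i ^^ (p - 1)) g \<in> S1 p + T_G" by (simp only:)
    let ?g = "g - (euler i ^^ (p - 1)) g"
    show ?case
    proof (intro bexI conjI allI)
      show "?g \<in> central_valued" using e subset g(1) free_alg.subspace_diff[OF sub'] by blast
      have "f - ?g = (f - g) + (euler i ^^ (p - 1)) g" by simp
      then show "f - ?g \<in> S1 p + T_G" by (simp only: free_alg.subspace_add[OF sub g(2) e])
      show "Poly_Mapping.lookup ?g w =
          (if \<forall>i\<in>insert i I. p dvd count_list (letters w) i then Poly_Mapping.lookup f w else 0)" for w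
        unfolding lookup_minus lookup_euler_funpow of_nat_power_p_minus_1 g(3) by simp
    qed
  qed
  then show ?thesis using that by blast
qed

end

section \<open>Words whose degree in every letter is divisible by \<open>p\<close>\<close>

text \<open>Adjacent transpositions connect all rearrangements of a word: the head letter of
  \<open>u\<close> is matched with an occurrence in \<open>v\<close> and moved there letter by
  letter. The swap is required only for rearrangements of \<open>w\<close>, so callers may use what
  they know about its multiset.\<close>

lemma perm_rel_induct:
  assumes refl: "\<And>u. R u u" and trans: "\<And>u v w. R u v \<Longrightarrow> R v w \<Longrightarrow> R u w"
    and swap: "\<And>l x y r. mset (l @ x # y # r) = mset w \<Longrightarrow> R (l @ x # y # r) (l @ y # x # r)"
    and mset: "mset u = mset w" "mset v = mset w"
  shows "R u v"
proof -
  have move: "R (l @ x # a @ r) (l @ a @ x # r)" if "mset (l @ x # a @ r) = mset w" for l x a r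
    using that
  proof (induction a arbitrary: l)
    case Nil
    show ?case by (simp add: refl)
  next
    case (Cons y a)
    have "R (l @ x # y # a @ r) (l @ y # x # a @ r)" using Cons.prems by (intro swap) simp
    moreover have "R ((l @ [y]) @ x # a @ r) ((l @ [y]) @ a @ x # r)"
      using Cons.prems by (intro Cons.IH) (simp add: add_mset_commute)
    ultimately show ?case by (auto intro: trans)
  qed
  have "R (l @ u) (l @ v)" if "mset (l @ u) = mset w" "mset (l @ v) = mset w" for l u v
    using that
  proof (induction u arbitrary: l v)
    case Nil
    then show ?case by (simp add: refl)
  next
    case (Cons x u)
    then have eq: "mset v = mset (x # u)"
      by (metis add_left_imp_eq mset_append)
    then have "x \<in> set v" by (metis list.set_intros(1) mset_eq_setD)
    then obtain a r where v: "v = a @ x # r" by (meson split_list)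
    have "R ((l @ [x]) @ u) ((l @ [x]) @ a @ r)"
      using Cons.prems eq v by (intro Cons.IH) simp_all
    moreover have "R (l @ x # a @ r) (l @ a @ x # r)"
      using Cons.prems v by (intro move) simp
    ultimately show ?case using v by (auto intro: trans)
  qed
  from this[of "[]" u v] mset show ?thesis by simp
qed

lemma ex_mset_repeat:
  assumes "\<And>i. (p::nat) dvd count M i"
  obtains r where "repeat_mset p (mset r) = M"
proof -
  define N where "N = Abs_multiset (\<lambda>i. count M i div p)"
  have "{i. 0 < count M i div p} \<subseteq> set_mset M"
    by (rule subsetI, rule ccontr) (simp add: not_in_iff)
  then have "finite {i. 0 < count M i div p}"
    by (rule finite_subset) simp
  then have "count N i = count M i div p" for i
    unfolding N_def by (simp add: count_Abs_multiset)
  then have "repeat_mset p N = M"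
    using assms by (intro multiset_eqI) simp
  moreover obtain r where "mset r = N" using ex_mset by blast
  ultimately show thesis using that by blast
qed

section \<open>Products of commutators in G\<close>

definition pair_letters :: "(nat \<times> nat) list \<Rightarrow> nat list"
  where "pair_letters P = concat (map (\<lambda>(i, j). [i, j]) P)"

lemma pair_letters_simps [simp]:
  "pair_letters [] = []"
  "pair_letters ((i, j) # P) = i # j # pair_letters P"
  by (simp_all add: pair_letters_def)

definition comm_prod :: "(nat \<Rightarrow> 'b::ring_1) \<Rightarrow> (nat \<times> nat) list \<Rightarrow> 'b"
  where "comm_prod a P = (\<Prod>(i, j)\<leftarrow>P. commutator (a i) (a j))"

lemma comm_prod_simps [simp]:
  "comm_prod a [] = 1"
  "comm_prod a ((i, j) # P) = commutator (a i) (a j) * comm_prod a P"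
  by (simp_all add: comm_prod_def)

lemma (in alg_hom) comm_prod: "\<phi> (comm_prod fvar P) = comm_prod (\<phi> \<circ> fvar) P"
  by (induction P) (auto simp: one mult commutator)

context
  assumes two: "(2 :: 'k::field) \<noteq> 0"
begin

text \<open>Commutators are central, so two that share a letter can be brought together, up to sign
  as \<open>[x,y][x,z]\<close>.\<close>

lemma commutator_mult_comm_prod_eq_0:
  fixes a :: "nat \<Rightarrow> 'k grassmann"
  assumes "i \<in> set (pair_letters P)"
  shows "commutator (a i) y * comm_prod a P = 0"
  using assms
proof (induction P)
  case (Cons x P)
  obtain j l where x: "x = (j, l)" by (cases x)
  have k: "commutator (a i) y * b = b * commutator (a i) y" for b
    by (rule centreD[OF commutator_centre])
  consider "i = j" | "i = l" | "i \<in> set (pair_letters P)" using Cons.prems x by auto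
  then have "commutator (a i) y * (commutator (a j) (a l) * comm_prod a P) = 0"
  proof cases
    case 1
    then show ?thesis
      by (simp add: commutator_mult_commutator[OF two] flip: mult.assoc)
  next
    case 2
    have "commutator (a j) (a i) = - commutator (a i) (a j)" by (simp add: commutator_def)
    then show ?thesis using 2
      by (simp add: commutator_mult_commutator[OF two] flip: mult.assoc)
  next
    case 3
    then show ?thesis using Cons.IH k by (metis mult.assoc mult_zero_right)
  qed
  then show ?case by (simp add: x)
qed simp

lemma comm_prod_eq_0:
  fixes a :: "nat \<Rightarrow> 'k grassmann"
  assumes "\<not> distinct (pair_letters P)"
  shows "comm_prod a P = 0"
  using assms
proof (induction P)
  case (Cons x P)
  obtain i j where x: "x = (i, j)" by (cases x)
  have neg: "commutator (a i) (a j) = - commutator (a j) (a i)" by (simp add: commutator_def)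
  consider "i = j" | "i \<in> set (pair_letters P)" | "j \<in> set (pair_letters P)"
    | "\<not> distinct (pair_letters P)" using Cons.prems x by auto
  then show ?case
  proof cases
    case 1
    then show ?thesis by (simp add: x commutator_def)
  next
    case 2
    then show ?thesis by (simp add: x commutator_mult_comm_prod_eq_0)
  next
    case 3
    then show ?thesis by (simp add: x neg commutator_mult_comm_prod_eq_0)
  next
    case 4
    then show ?thesis by (simp add: x Cons.IH)
  qed
qed simp

end

text \<open>The central commutators are collected on the right, which gives a generator of
  \<open>S1\<close> the shape of a word times \<open>comm_prod\<close>.\<close>

lemma prod_pairs_gather_commutators:
  fixes a :: "nat \<Rightarrow> 'k::field grassmann"
  shows "(\<Prod>(i, j)\<leftarrow>P. commutator (a i) (a j) * a i ^ m * a j ^ m) =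
    (\<Prod>i\<leftarrow>pair_letters P. a i ^ m) * comm_prod a P"
proof (induction P)
  case (Cons x P)
  obtain i j where x: "x = (i, j)" by (cases x)
  have k: "commutator (a i) (a j) * b = b * commutator (a i) (a j)" for b
    by (rule centreD[OF commutator_centre])
  have move: "commutator (a i) (a j) * (a i ^ m * (a j ^ m * (w * c))) =
      a i ^ m * (a j ^ m * (w * (commutator (a i) (a j) * c)))" for w c
    by (metis k mult.assoc)
  have "(\<Prod>(i, j)\<leftarrow>x # P. commutator (a i) (a j) * a i ^ m * a j ^ m) =
      commutator (a i) (a j) * a i ^ m * a j ^ m *
        ((\<Prod>i\<leftarrow>pair_letters P. a i ^ m) * comm_prod a P)"
    by (simp only: x Cons.IH list.map prod_list.Cons prod.case)
  also have "\<dots> = a i ^ m * (a j ^ m * ((\<Prod>i\<leftarrow>pair_letters P. a i ^ m) *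
      (commutator (a i) (a j) * comm_prod a P)))"
    using move by (simp only: mult.assoc)
  finally show ?case by (simp add: x mult.assoc)
qed simp

lemma word_eval_replicate_power:
  "word_eval a (concat (replicate n r)) = word_eval a r ^ n"
  by (induction n) simp_all

lemma word_eval_concat_replicate:
  "word_eval a (concat (map (replicate n) J)) = (\<Prod>i\<leftarrow>J. a i ^ n)"
proof -
  have "word_eval a (replicate n i) = a i ^ n" for i by (induction n) simp_all
  then show ?thesis by (induction J) simp_all
qed

lemma count_concat_map_replicate:
  "count (mset (concat (map (replicate n) J))) i = n * count (mset J) i"
  by (induction J) (auto simp: algebra_simps)

lemma count_concat_replicate:
  "mset (concat (replicate n r)) = repeat_mset n (mset r)"
  by (induction n) simp_all

context
  fixes p :: nat
  assumes char: "CHAR('k::field) = p" and p_gt_2: "p > 2"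
begin

text \<open>Substituting \<open>x\<^sub>1 := r\<close> and the pairs in \<open>P\<close> for \<open>(x\<^bsub>2i\<^esub>, x\<^bsub>2i+1\<^esub>)\<close> into a generator of \<open>S\<^sub>1\<close>.\<close>

lemma S1_generator_instance:
  "mon r ^ p * (\<Prod>(i, j)\<leftarrow>P. commutator (fvar i) (fvar j) * fvar i ^ (p-1) * fvar j ^ (p-1))
    \<in> (S1 p :: 'k free_alg set)"
proof (cases "P = []")
  \<comment> \<open>The second family in \<open>S1\<close> starts at \<open>n = 1\<close>; the empty
    product is covered by \<open>x_1^p\<close> in the first.\<close>
  case True
  let ?Y = "{commutator (fvar 1) (fvar 2), fvar 1 ^ p} :: 'k free_alg set"
  interpret E: alg_hom fscale "free_alg.eval (\<lambda>_. mon r) :: 'k free_alg \<Rightarrow> 'k free_alg"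
    by unfold_locales (rule free_alg.eval_hom)
  have "free_alg.eval (\<lambda>_. mon r) (fvar 1 ^ p) \<in> T_space_gen ?Y"
    by (rule T_space_gen_hom[OF _ E.hom]) simp
  then have "mon r ^ p \<in> T_space_gen ?Y"
    unfolding E.power free_alg.eval_fvar .
  then show ?thesis using T_space_gen_subset_S1(1) True by auto
next
  case False
  define F where "F i = commutator (fvar (2*i)) (fvar (2*i+1)) * fvar (2*i) ^ (p-1) *
    (fvar (2*i+1) ^ (p-1) :: 'k free_alg)" for i :: nat
  \<comment> \<open>Pairs are numbered from 1 in the generator and from 0 in the list: letters
    \<open>2i\<close> and \<open>2i+1\<close> both have quotient \<open>i\<close> by 2, hence the
    index \<open>m div 2 - 1\<close>.\<close>
  define a :: "nat \<Rightarrow> 'k free_alg" where "a m =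
    (if m = 1 then mon r
     else if even m then fvar (fst (P ! (m div 2 - 1))) else fvar (snd (P ! (m div 2 - 1))))" for m
  interpret E: alg_hom fscale "free_alg.eval a"
    by unfold_locales (rule free_alg.eval_hom)
  have "free_alg.eval a (fvar 1 ^ p * (\<Prod>i\<leftarrow>[1..<length P + 1]. F i))
    \<in> T_space_gen {fvar 1 ^ p * (\<Prod>i\<leftarrow>[1..<n+1].
        commutator (fvar (2*i)) (fvar (2*i+1)) * fvar (2*i) ^ (p-1) * fvar (2*i+1) ^ (p-1)) | n. n \<ge> 1}"
  proof (rule T_space_gen_hom[OF _ E.hom], intro CollectI exI conjI)
    show "length P \<ge> 1" using False by (cases P) simp_all
  qed (simp only: F_def)
  also have "free_alg.eval a (fvar 1 ^ p * (\<Prod>i\<leftarrow>[1..<length P + 1]. F i)) =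
      mon r ^ p * (\<Prod>i\<leftarrow>[1..<length P + 1]. free_alg.eval a (F i))"
    by (simp only: E.mult E.power E.prod_list free_alg.eval_fvar) (simp add: a_def)
  also have "map (\<lambda>i. free_alg.eval a (F i)) [1..<length P + 1] =
      map (\<lambda>(i, j). commutator (fvar i) (fvar j) * fvar i ^ (p-1) * fvar j ^ (p-1)) P"
  proof (rule nth_equalityI)
    fix n assume "n < length (map (\<lambda>i. free_alg.eval a (F i)) [1..<length P + 1])"
    then have n: "n < length P" by (simp del: upt_Suc)
    have "a (2 * (n + 1)) = fvar (fst (P ! n))" "a (2 * (n + 1) + 1) = fvar (snd (P ! n))"
      by (simp_all add: a_def)
    then have "free_alg.eval a (F (n + 1)) = commutator (fvar (fst (P ! n))) (fvar (snd (P ! n)))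
        * fvar (fst (P ! n)) ^ (p-1) * fvar (snd (P ! n)) ^ (p-1)"
      unfolding F_def E.mult E.commutator E.power free_alg.eval_fvar by simp
    then show "map (\<lambda>i. free_alg.eval a (F i)) [1..<length P + 1] ! n =
        map (\<lambda>(i, j). commutator (fvar i) (fvar j) * fvar i ^ (p-1) * fvar j ^ (p-1)) P ! n"
      using n by (simp add: case_prod_unfold del: upt_Suc)
  qed (simp del: upt_Suc)
  finally show ?thesis using T_space_gen_subset_S1(2) by blast
qed

text \<open>Swapping two adjacent letters trades the word for a shorter one times a commutator, so by
  induction on the length of \<open>u\<close> only one arrangement of its letters has to be examined.\<close>

lemma mon_mult_comm_prod_mem:
  assumes "\<And>i. p dvd count (mset u + mset (pair_letters P)) i"
  shows "mon u * comm_prod fvar P \<in> (S1 p + T_G :: 'k free_alg set)"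
  using assms
proof (induction "length u" arbitrary: u P rule: less_induct)
  case less
  let ?V = "S1 p + T_G :: 'k free_alg set"
  let ?c = "comm_prod fvar P :: 'k free_alg"
  let ?J = "pair_letters P"
  note sub = S1_plus_T_G_subspace[of p, where 'a = 'k]
  note two = two_neq_0[OF char p_gt_2]
  show ?case
  proof (cases "distinct ?J")
    case False
    have "mon u * ?c \<in> T_G"
    proof (rule T_GI)
      fix \<phi> :: "'k free_alg \<Rightarrow> 'k grassmann"
      assume "alg_hom gscale \<phi>"
      then interpret alg_hom gscale \<phi> .
      show "\<phi> (mon u * ?c) = 0"
        by (simp add: mult comm_prod comm_prod_eq_0[OF two False])
    qed
    then show ?thesis using T_G_subset_S1_plus_T_G by blast
  next
    case True
    have swap: "mon (l @ x # y # r) * ?c - mon (l @ y # x # r) * ?c \<in> ?V"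
      if eq: "mset (l @ x # y # r) = mset u" for l x y r
    proof -
      \<comment> \<open>The letters \<open>x\<close> and \<open>y\<close> pass from the word to the
        list of pairs, so the total degrees and their divisibility by \<open>p\<close> are
        preserved.\<close>
      let ?d = "mon (l @ r) * comm_prod fvar ((x, y) # P) :: 'k free_alg"
      have letters: "mset (l @ r) + mset (pair_letters ((x, y) # P)) = mset u + mset ?J"
        by (simp flip: eq)
      have "?d \<in> ?V"
      proof (rule less.hyps)
        show "length (l @ r) < length u" using mset_eq_length[OF eq] by simp
        show "p dvd count (mset (l @ r) + mset (pair_letters ((x, y) # P))) i" for i
          unfolding letters by (rule less.prems)
      qed
      moreover have "mon (l @ x # y # r) * ?c - mon (l @ y # x # r) * ?c - ?d \<in> T_G"
      proof (rule T_GI)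
        fix \<phi> :: "'k free_alg \<Rightarrow> 'k grassmann"
        assume "alg_hom gscale \<phi>"
        then interpret alg_hom gscale \<phi> .
        define a where "a = \<phi> \<circ> fvar"
        let ?e = "word_eval a" and ?k = "commutator (a x) (a y)"
        have "?k * b = b * ?k" for b by (rule centreD[OF commutator_centre])
        then have "?e l * ?e r * (?k * comm_prod a P) = ?e l * (?k * (?e r * comm_prod a P))"
          by (metis mult.assoc)
        also have "\<dots> = ?e l * a x * a y * ?e r * comm_prod a P - ?e l * a y * a x * ?e r * comm_prod a P"
          by (simp add: commutator_def algebra_simps)
        finally show "\<phi> (mon (l @ x # y # r) * ?c - mon (l @ y # x # r) * ?c - ?d) = 0"
          by (simp add: diff mult mon comm_prod mult.assoc del: comm_prod_simps flip: a_def)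
            (simp add: mult.assoc)
      qed
      ultimately show ?thesis
        using free_alg.subspace_add[OF sub, of ?d
            "mon (l @ x # y # r) * ?c - mon (l @ y # x # r) * ?c - ?d"]
          T_G_subset_S1_plus_T_G[of p, where 'a = 'k] by (simp add: subset_iff)
    qed
    have arrange: "mon u * ?c - mon v * ?c \<in> ?V" if "mset v = mset u" for v
    proof (rule perm_rel_induct[where w = u and R = "\<lambda>u v. mon u * ?c - mon v * ?c \<in> ?V"])
      fix u v w assume "mon u * ?c - mon v * ?c \<in> ?V" "mon v * ?c - mon w * ?c \<in> ?V"
      then have "(mon u * ?c - mon v * ?c) + (mon v * ?c - mon w * ?c) \<in> ?V"
        by (rule free_alg.subspace_add[OF sub])
      then show "mon u * ?c - mon w * ?c \<in> ?V" by simp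
    qed (use swap that free_alg.subspace_0[OF sub] in simp_all)
    \<comment> \<open>A letter of \<open>?J\<close> occurs there once, and its positive total degree
      is divisible by \<open>p\<close>. So \<open>u\<close> holds at least \<open>p - 1\<close>
      copies of it.\<close>
    have le: "p * count (mset ?J) i \<le> count (mset u + mset ?J) i" for i
    proof (cases "i \<in> set ?J")
      case i: True
      then have "count (mset ?J) i = 1" using True by (simp add: distinct_count_atmost_1)
      then show ?thesis using less.prems[of i] by (auto dest: dvd_imp_le)
    next
      case False
      then show ?thesis by (simp add: count_mset count_notin)
    qed
    obtain r where r: "repeat_mset p (mset r) = mset u + mset ?J - repeat_mset p (mset ?J)"
      using ex_mset_repeat[of p "mset u + mset ?J - repeat_mset p (mset ?J)"] less.prems
      by (metis count_diff count_repeat_mset dvd_diff_nat dvd_triv_left)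
    \<comment> \<open>Chosen to match a generator: together with the commutators, the powers
      \<open>p - 1\<close> use \<open>p\<close> copies of each letter of \<open>?J\<close>, and the
      rest form the \<open>p\<close>-th power of the word \<open>r\<close>.\<close>
    let ?v = "concat (replicate p r) @ concat (map (replicate (p - 1)) ?J)"
    have "mset ?v = mset u"
    proof (rule multiset_eqI)
      fix i
      have "count (mset ?v) i = count (repeat_mset p (mset r)) i + (p - 1) * count (mset ?J) i"
        unfolding mset_append count_union count_concat_replicate count_concat_map_replicate ..
      also have "\<dots> = count (mset u) i"
        unfolding r using le[of i] p_gt_2 by (simp add: diff_mult_distrib)
      finally show "count (mset ?v) i = count (mset u) i" .
    qed
    then have diff: "mon u * ?c - mon ?v * ?c \<in> ?V" by (rule arrange)
    let ?g = "mon r ^ p * (\<Prod>(i, j)\<leftarrow>P. commutator (fvar i) (fvar j) * fvar i ^ (p-1) * fvar j ^ (p-1))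
      :: 'k free_alg"
    have "mon ?v * ?c - ?g \<in> T_G"
    proof (rule T_GI)
      fix \<phi> :: "'k free_alg \<Rightarrow> 'k grassmann"
      assume "alg_hom gscale \<phi>"
      then interpret alg_hom gscale \<phi> .
      define a where "a = \<phi> \<circ> fvar"
      have "\<phi> (mon ?v * ?c) = word_eval a r ^ p * (\<Prod>i\<leftarrow>?J. a i ^ (p-1)) * comm_prod a P"
        by (simp add: mult mon comm_prod word_eval_replicate_power word_eval_concat_replicate
            del: map_map flip: a_def)
      also have "\<dots> = word_eval a r ^ p *
          (\<Prod>(i, j)\<leftarrow>P. commutator (a i) (a j) * a i ^ (p-1) * a j ^ (p-1))"
        unfolding prod_pairs_gather_commutators by (simp add: mult.assoc)
      also have "\<dots> = \<phi> ?g"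
        by (simp add: mult power prod_list mon commutator a_def case_prod_unfold)
      finally show "\<phi> (mon ?v * ?c - ?g) = 0" by (simp add: diff)
    qed
    moreover have "?g \<in> ?V"
      using S1_generator_instance S1_subset_S1_plus_T_G by blast
    ultimately have "(mon u * ?c - mon ?v * ?c) + ((mon ?v * ?c - ?g) + ?g) \<in> ?V"
      using T_G_subset_S1_plus_T_G diff by (intro free_alg.subspace_add[OF sub]) auto
    then show ?thesis by simp
  qed
qed

text \<open>Reducing with respect to the finitely many letters of \<open>f\<close> suffices, as
  every other letter has degree 0 in all its words. The surviving words are covered by
  \<open>mon_mult_comm_prod_mem\<close> with the empty list of pairs.\<close>

lemma central_valued_subset_S1_plus_T_G: "central_valued \<subseteq> (S1 p + T_G :: 'k free_alg set)"
proof
  fix f :: "'k free_alg"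
  assume f: "f \<in> central_valued"
  note sub = S1_plus_T_G_subspace[of p, where 'a = 'k]
  let ?I = "\<Union>w\<in>Poly_Mapping.keys f. set (letters w)"
  obtain g where g: "f - g \<in> S1 p + T_G" "\<And>w. Poly_Mapping.lookup g w =
      (if \<forall>i\<in>?I. p dvd count_list (letters w) i then Poly_Mapping.lookup f w else 0)"
    by (rule central_valued_reduce[OF char p_gt_2 _ f, of ?I]) auto
  have "mon (letters w) \<in> (S1 p + T_G :: 'k free_alg set)" if "w \<in> Poly_Mapping.keys g" for w
  proof -
    have *: "w \<in> Poly_Mapping.keys f" "\<forall>i\<in>?I. p dvd count_list (letters w) i"
      using that g(2)[of w] by (auto simp: in_keys_iff split: if_splits)
    have "p dvd count (mset (letters w) + mset (pair_letters [])) i" for i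
    proof (cases "i \<in> set (letters w)")
      case True
      then show ?thesis using * by (auto simp: count_mset)
    next
      case False
      then show ?thesis by (simp add: count_mset count_notin)
    qed
    from mon_mult_comm_prod_mem[OF this] show ?thesis by simp
  qed
  then have "g \<in> S1 p + T_G"
    by (subst fmon_sum_monomials)
      (intro free_alg.subspace_sum[OF sub] free_alg.subspace_scale[OF sub])
  with g(1) have "(f - g) + g \<in> S1 p + T_G"
    by (rule free_alg.subspace_add[OF sub])
  then show "f \<in> S1 p + T_G" by simp
qed

end

theorem theorem3p1:
  assumes "infinite (UNIV :: 'k::field set)" and "CHAR('k) = p" and "p > 2"
  shows "(CP_G :: 'k free_alg set) = S1 p + T_G"
  using CP_G_subset_central_valued central_valued_subset_CP_G[OF assms(2,3)]
    central_valued_subset_S1_plus_T_G[OF assms(2,3)]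
    S1_plus_T_G_subset_central_valued[OF assms(2,3)]
  by blast

end
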